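(* There exist two complex vector spaces $F_1, F_2 \subseteq U(T)\cup\{0\}$ (vector subspaces of $H(T)$), each dense in $H(T)$, such that $F_1 \cap F_2 = \{0\}$.
   Context: Here $\mathbb{N}=\{1,2,3,\dots\}$. $T$ is the set of vertices of a rooted tree with root $x_0$. $T_0=\{x_0\}$ and, for $n\in\mathbb{N}$, $T_n$ is the set of vertices at distance $n$ from $x_0$. For $x\in T$, $S(x)$ denotes the set of children of $x$. It is assumed that every $T_n$ is finite and every $S(x)$ has at least two elements (so $T$ is countably infinite). For each $x\in T$ and $y\in S(x)$ a real number $q(x,y)>0$ is given, with $\sum_{y\in S(x)}q(x,y)=1$ for every $x\in T$. Boundary: $\partial T$ is the set of infinite geodesics from $x_0$, i.e. sets $e=\{z_n:n\in\mathbb{N}\}$ with $z_1=x_0$ and $z_{n+1}\in S(z_n)$ for all $n$. For $x\in T$, $B_x=\{e\in\partial T: x\in e\}$. For $n\in\mathbb{N}$, $\mathcal{M}_n$ is the $\sigma$-algebra on $\partial T$ generated by the finite partition $\{B_x:x\in T_n\}$. For $x\in T_n$, with path $y_0=x_0,\dots,y_n=x$, $y_{j+1}\in S(y_j)$, put $p(B_x)=\prod_{j=0}^{n-1}q(y_j,y_{j+1})$; this determines a probability measure $\mathbb{P}_n$ on $\mathcal{M}_n$. By Kolmogorov's consistency theorem there is a probability measure $\mathbb{P}$ on $(\partial T,\mathcal{M})$, where $\mathcal{M}$ is the completion of the $\sigma$-algebra generated by $\bigcup_n\mathcal{M}_n$, with $\mathbb{P}|_{\mathcal{M}_n}=\mathbb{P}_n$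 for all $n$. $L^0(\partial T)$ is the space of $\mathcal{M}$-measurable functions $\partial T\to\mathbb{C}$, modulo almost everywhere equality, with the metric $P(\psi,\phi)=\int_{\partial T}\frac{|\psi(e)-\phi(e)|}{1+|\psi(e)-\phi(e)|}\,d\mathbb{P}(e)$ (topology of convergence in probability). $\mathbb{C}^T$ carries the metric $\rho(f,g)=\sum_{n=1}^\infty 2^{-n}\frac{|f(z_n)-g(z_n)|}{1+|f(z_n)-g(z_n)|}$, where $\{z_n:n\in\mathbb{N}\}$ is an enumeration of $T$ (topology of pointwise convergence). A function $f\in\mathbb{C}^T$ is harmonic if $f(x)=\sum_{y\in S(x)}q(x,y)f(y)$ for all $x\in T$; $H(T)\subseteq\mathbb{C}^T$ is the set of harmonic functions, with the subspace topology. For $f\in H(T)$ and $n\in\mathbb{N}$, $\omega_n(f):\partial T\to\mathbb{C}$ is given by $\omega_n(f)(e)=f(z)$, where $z$ is the unique element of $e\cap T_n$. A function $f\in H(T)$ is universal if the sequence $\{\omega_n(f)\}_{n=1}^\infty$ is dense in $L^0(\partial T)$; $U(T)$ denotes the set of universal functions. *)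

theory Defs
  imports "HOL-Probability.Probability" "HOL-Library.Function_Algebras"
begin

text \<open>
  A tree is a connected simple graph without cycles, given by its adjacency relation \<open>E\<close>.
  The vertex set is the whole type \<open>'v\<close>, so that a function on the vertices is just a
  function on \<open>'v\<close>.
\<close>

definition is_tree :: "('v \<Rightarrow> 'v \<Rightarrow> bool) \<Rightarrow> bool" where
  "is_tree E \<longleftrightarrow>
     symp E \<and> irreflp E \<and>
     (\<forall>x y. E\<^sup>*\<^sup>* x y) \<and>
     \<not> (\<exists>c. 3 \<le> length c \<and> distinct c \<and> successively E c \<and> E (last c) (hd c))"

definition tree_dist :: "('v \<Rightarrow> 'v \<Rightarrow> bool) \<Rightarrow> 'v \<Rightarrow> 'v \<Rightarrow> nat" where
  "tree_dist E x y = (LEAST n. (E ^^ n) x y)"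

definition level :: "('v \<Rightarrow> 'v \<Rightarrow> bool) \<Rightarrow> 'v \<Rightarrow> nat \<Rightarrow> 'v set" where
  "level E x0 n = {x. tree_dist E x0 x = n}"

definition children :: "('v \<Rightarrow> 'v \<Rightarrow> bool) \<Rightarrow> 'v \<Rightarrow> 'v \<Rightarrow> 'v set" where
  "children E x0 x = {y. E x y \<and> tree_dist E x0 y = Suc (tree_dist E x0 x)}"


text \<open>Geodesics are indexed from \<open>0\<close>, so that \<open>z n\<close> lies in \<open>level E x0 n\<close>.\<close>

definition boundary :: "('v \<Rightarrow> 'v \<Rightarrow> bool) \<Rightarrow> 'v \<Rightarrow> 'v set set" where
  "boundary E x0 = {range z | z. z 0 = x0 \<and> (\<forall>n::nat. z (Suc n) \<in> children E x0 (z n))}"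

definition cylinder :: "('v \<Rightarrow> 'v \<Rightarrow> bool) \<Rightarrow> 'v \<Rightarrow> 'v \<Rightarrow> 'v set set" where
  "cylinder E x0 x = {e \<in> boundary E x0. x \<in> e}"

definition level_algebra :: "('v \<Rightarrow> 'v \<Rightarrow> bool) \<Rightarrow> 'v \<Rightarrow> nat \<Rightarrow> 'v set set set" where
  "level_algebra E x0 n = sigma_sets (boundary E x0) (cylinder E x0 ` level E x0 n)"

text \<open>
  \<open>M\<close> is the completed Kolmogorov measure: the completion of the probability measure on the
  \<open>\<sigma>\<close>-algebra generated by all \<open>level_algebra E x0 n\<close> which gives the cylinder at the endpoint
  of a path from the root the product of the weights \<open>q\<close> along that path.
\<close>

definition is_boundary_measure ::
  "('v \<Rightarrow> 'v \<Rightarrow> bool) \<Rightarrow> 'v \<Rightarrow> ('v \<Rightarrow> 'v \<Rightarrow> real) \<Rightarrow> 'v set measure \<Rightarrow> bool" where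
  "is_boundary_measure E x0 q M \<longleftrightarrow>
     (\<exists>P. prob_space P \<and>
          space P = boundary E x0 \<and>
          sets P = sigma_sets (boundary E x0) (\<Union>n\<in>{1..}. level_algebra E x0 n) \<and>
          (\<forall>n\<ge>1. \<forall>y. y 0 = x0 \<and> (\<forall>j<n. y (Suc j) \<in> children E x0 (y j)) \<longrightarrow>
             measure P (cylinder E x0 (y n)) = (\<Prod>j<n. q (y j) (y (Suc j)))) \<and>
          M = completion P)"


text \<open>
  Density with respect to a metric or pseudometric \<open>d\<close>. For a pseudometric this is density of
  the set of classes of \<open>A\<close> in the quotient of \<open>X\<close> by \<open>d x y = 0\<close>.
\<close>

definition dense_wrt :: "('a \<Rightarrow> 'a \<Rightarrow> real) \<Rightarrow> 'a set \<Rightarrow> 'a set \<Rightarrow> bool" where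
  "dense_wrt d X A \<longleftrightarrow> A \<subseteq> X \<and> (\<forall>x\<in>X. \<forall>\<epsilon>>0. \<exists>a\<in>A. d x a < \<epsilon>)"

text \<open>
  The elements of \<open>L0 M\<close> are functions, not classes modulo almost everywhere equality; two of
  them are almost everywhere equal iff \<open>prob_dist M\<close> vanishes on them.
\<close>

definition L0 :: "'a measure \<Rightarrow> ('a \<Rightarrow> complex) set" where
  "L0 M = borel_measurable M"

definition prob_dist :: "'a measure \<Rightarrow> ('a \<Rightarrow> complex) \<Rightarrow> ('a \<Rightarrow> complex) \<Rightarrow> real" where
  "prob_dist M \<psi> \<phi> = (\<integral>e. cmod (\<psi> e - \<phi> e) / (1 + cmod (\<psi> e - \<phi> e)) \<partial>M)"

text \<open>The enumeration \<open>z\<close> of the vertices starts at \<open>0\<close>, hence the exponent \<open>Suc n\<close>.\<close>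

definition pointwise_dist :: "(nat \<Rightarrow> 'v) \<Rightarrow> ('v \<Rightarrow> complex) \<Rightarrow> ('v \<Rightarrow> complex) \<Rightarrow> real" where
  "pointwise_dist z f g =
     (\<Sum>n. (1 / 2) ^ Suc n * (cmod (f (z n) - g (z n)) / (1 + cmod (f (z n) - g (z n)))))"


definition harmonic ::
  "('v \<Rightarrow> 'v \<Rightarrow> bool) \<Rightarrow> 'v \<Rightarrow> ('v \<Rightarrow> 'v \<Rightarrow> real) \<Rightarrow> ('v \<Rightarrow> complex) set" where
  "harmonic E x0 q =
     {f. \<forall>x. f x = (\<Sum>y\<in>children E x0 x. complex_of_real (q x y) * f y)}"

definition omega ::
  "('v \<Rightarrow> 'v \<Rightarrow> bool) \<Rightarrow> 'v \<Rightarrow> nat \<Rightarrow> ('v \<Rightarrow> complex) \<Rightarrow> 'v set \<Rightarrow> complex" where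
  "omega E x0 n f e = f (THE x. x \<in> e \<inter> level E x0 n)"

definition universal ::
  "('v \<Rightarrow> 'v \<Rightarrow> bool) \<Rightarrow> 'v \<Rightarrow> ('v \<Rightarrow> 'v \<Rightarrow> real) \<Rightarrow> 'v set measure \<Rightarrow> ('v \<Rightarrow> complex) set" where
  "universal E x0 q M =
     {f \<in> harmonic E x0 q. dense_wrt (prob_dist M) (L0 M) {omega E x0 n f | n. 1 \<le> n}}"

global_interpretation complex_fun: vector_space "\<lambda>(c::complex) (f::'v \<Rightarrow> complex) x. c * f x"
  by unfold_locales (auto simp: fun_eq_iff algebra_simps)

end

theory Submission
  imports Defs "HOL-Library.Discrete_Functions"
begin

text \<open>
  Every vertex \<open>x\<close> has a child, its sink, of conditional probability at most \<open>1 / 2\<close>. A harmonic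
  function may be prescribed arbitrarily at the root and at all non-sink vertices, the values at
  the sinks being then forced. If the same constant is prescribed at all non-sink descendants of
  \<open>x\<close> down to \<open>k\<close> further generations, then the function takes this constant at all vertices
  \<open>k\<close> generations below \<open>x\<close> except the one reached through sinks only, which has
  conditional probability at most \<open>2 ^ - k\<close>.

  So one prescribes a family \<open>f_i\<close> of harmonic functions, indexed by two copies of the vertex set:
  \<open>f_(y, b)\<close> vanishes above the level of \<open>y\<close> and is the indicator of \<open>y\<close> at the non-sinks
  of that level; below, the levels \<open>2 ^ j, \<dots>, 2 ^ (j + 1) - 1\<close> carry a task \<open>(k, \<phi>)\<close>, where
  \<open>\<phi>\<close> is a simple cylinder function, which asks \<open>f_k\<close> to approach \<open>\<phi>\<close> and all the other \<open>f_i\<close> to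
  approach \<open>0\<close>. Every task from a countable dense set occurs infinitely often, so each nontrivial
  combination of the \<open>f_i\<close> is universal. In particular the \<open>f_i\<close> are linearly independent, so that
  the spans for \<open>b = True\<close> and \<open>b = False\<close> meet in \<open>0\<close>, and either span contains a function agreeing
  with a given harmonic function on any finite number of levels.
\<close>

section \<open>Rooted trees: parents, rays and cylinders\<close>

locale rooted_tree =
  fixes E :: "'v \<Rightarrow> 'v \<Rightarrow> bool" and x0 :: 'v
  assumes tree: "is_tree E"
begin

abbreviation lev :: "'v \<Rightarrow> nat" where "lev \<equiv> tree_dist E x0"
abbreviation ch :: "'v \<Rightarrow> 'v set" where "ch \<equiv> children E x0"
abbreviation bd :: "'v set set" where "bd \<equiv> boundary E x0"
abbreviation cyl :: "'v \<Rightarrow> 'v set set" where "cyl \<equiv> cylinder E x0"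

lemma relpowp_lev: "(E ^^ lev x) x0 x"
proof -
  have "E\<^sup>*\<^sup>* x0 x" using tree by (auto simp: is_tree_def)
  then obtain n where "(E ^^ n) x0 x" by (auto dest: rtranclp_imp_relpowp)
  then show ?thesis unfolding tree_dist_def by (rule LeastI)
qed

lemma lev_le: "(E ^^ n) x0 x \<Longrightarrow> lev x \<le> n"
  unfolding tree_dist_def by (rule Least_le)

lemma lev_root [simp]: "lev x0 = 0"
  using lev_le[of 0 x0] by simp

lemma lev_eq_0_iff [simp]: "lev x = 0 \<longleftrightarrow> x = x0"
  using relpowp_lev[of x] by auto

lemma lev_child: "y \<in> ch x \<Longrightarrow> lev y = Suc (lev x)"
  by (simp add: children_def)

text \<open>The parent is the last vertex but one on a shortest path from the root: if its level
  were smaller than \<open>n\<close>, the path to \<open>x\<close> could be shortened.\<close>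

lemma ex_parent:
  assumes "x \<noteq> x0"
  shows "\<exists>y. x \<in> ch y"
proof -
  obtain n where n: "lev x = Suc n"
    using assms lev_eq_0_iff not0_implies_Suc by blast
  then have "(E ^^ Suc n) x0 x" using relpowp_lev[of x] by simp
  then obtain y where y: "(E ^^ n) x0 y" "E y x" by (auto elim: relpowp_Suc_E)
  have "lev x \<le> Suc (lev y)"
    using relpowp_Suc_I[OF relpowp_lev[of y] y(2)] by (rule lev_le)
  then have "lev y = n" using lev_le[OF y(1)] n by simp
  then show ?thesis using y n by (auto simp: children_def)
qed

text \<open>Together with a common child of \<open>p\<close> and \<open>p'\<close>, such a path would close up to a cycle.\<close>

lemma ex_path_within_levels:
  assumes "lev p = n" "lev p' = n" "p \<noteq> p'"
  shows "\<exists>c. 2 \<le> length c \<and> distinct c \<and> successively E c \<and> hd c = p \<and> last c = p' \<and>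
    (\<forall>v\<in>set c. lev v \<le> n)"
  using assms
proof (induction n arbitrary: p p')
  case 0
  then show ?case by simp
next
  case (Suc n)
  have symE: "E a b \<Longrightarrow> E b a" for a b using tree by (auto simp: is_tree_def symp_def)
  have "p \<noteq> x0" "p' \<noteq> x0" using Suc.prems by auto
  then obtain r r' where r: "p \<in> ch r" "p' \<in> ch r'" using ex_parent by blast
  then have lr: "lev r = n" "lev r' = n" using Suc.prems lev_child[OF r(1)] lev_child[OF r(2)] by simp_all
  have e: "E p r" "E r' p'" using r symE by (auto simp: children_def)
  show ?case
  \<comment> \<open>Either the parents coincide and give a path of three vertices, or the path
    between them from the induction hypothesis is prolonged at both ends. Its vertices have level at
    most \<open>n\<close>, so neither \<open>p\<close> nor \<open>p'\<close> is among them.\<close>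
  proof (cases "r = r'")
    case True
    have "p \<noteq> r" "p' \<noteq> r" using Suc.prems(1,2) lr n_not_Suc_n by metis+
    then show ?thesis using True e lr Suc.prems
      by (intro exI[of _ "[p, r, p']"]) auto
  next
    case False
    obtain c where c: "2 \<le> length c" "distinct c" "successively E c" "hd c = r" "last c = r'"
        "\<forall>v\<in>set c. lev v \<le> n"
      using Suc.IH[OF lr False] by blast
    have "p \<notin> set c" "p' \<notin> set c" using c(6) Suc.prems(1,2) Suc_n_not_le_n by metis+
    moreover have "c \<noteq> []" using c(1) by auto
    moreover have "lev v \<le> Suc n" if "v \<in> set c" for v using c(6) that by (simp add: le_SucI)
    ultimately have "2 \<le> length (p # c @ [p'])" "distinct (p # c @ [p'])"
        "successively E (p # c @ [p'])" "\<forall>v\<in>set (p # c @ [p']). lev v \<le> Suc n"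
      using c(2-5) e Suc.prems by (simp_all add: successively_Cons successively_append_iff)
    then show ?thesis by (intro exI[of _ "p # c @ [p']"]) simp
  qed
qed

lemma parent_unique:
  assumes "x \<in> ch p" "x \<in> ch p'"
  shows "p = p'"
proof (rule ccontr)
  assume "p \<noteq> p'"
  have symE: "E a b \<Longrightarrow> E b a" for a b using tree by (auto simp: is_tree_def symp_def)
  have l: "lev p' = lev p" using lev_child[OF assms(1)] lev_child[OF assms(2)] by simp
  obtain c where c: "2 \<le> length c" "distinct c" "successively E c" "hd c = p" "last c = p'"
      "\<forall>v\<in>set c. lev v \<le> lev p"
    using ex_path_within_levels[OF refl l \<open>p \<noteq> p'\<close>] by blast
  have "x \<notin> set c" using c(6) lev_child[OF assms(1)] by auto
  moreover have "c \<noteq> []" using c(1) by auto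
  moreover have "E x p" "E p' x" using assms symE by (auto simp: children_def)
  ultimately have "3 \<le> length (x # c)" "distinct (x # c)" "successively E (x # c)"
      "E (last (x # c)) (hd (x # c))"
    using c by (auto simp: successively_Cons)
  then show False using tree unfolding is_tree_def by blast
qed

definition parent :: "'v \<Rightarrow> 'v" where
  "parent y = (THE x. y \<in> ch x)"

lemma parent_eq: "y \<in> ch x \<Longrightarrow> parent y = x"
  unfolding parent_def using parent_unique by blast

lemma child_parent: "y \<noteq> x0 \<Longrightarrow> y \<in> ch (parent y)"
  using ex_parent parent_eq by force

lemma root_not_child: "x0 \<notin> ch x"
  by (auto simp: children_def)

lemma ex_root_path:
  "\<exists>p. p 0 = x0 \<and> p (lev x) = x \<and> (\<forall>j<lev x. p (Suc j) \<in> ch (p j))"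
proof (induction "lev x" arbitrary: x)
  case 0
  then show ?case by (intro exI[of _ "\<lambda>_. x0"]) simp
next
  case (Suc n)
  then have "x \<noteq> x0" by auto
  then have x: "x \<in> ch (parent x)" by (rule child_parent)
  have l: "lev (parent x) = n" using lev_child[OF x] Suc by simp
  obtain p where p: "p 0 = x0" "p n = parent x" "\<forall>j<n. p (Suc j) \<in> ch (p j)"
    using Suc.hyps(1)[of "parent x"] l by auto
  show ?case using p x
    by (intro exI[of _ "p(Suc n := x)"]) (auto simp: Suc.hyps(2)[symmetric] less_Suc_eq)
qed

text \<open>Names the vertex chosen in \<open>omega\<close>. A geodesic, which is a mere set of
  vertices, can thereby be handled as the sequence \<open>\<lambda>n. vtx n e\<close>.\<close>

definition vtx :: "nat \<Rightarrow> 'v set \<Rightarrow> 'v" where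
  "vtx n e = (THE x. x \<in> e \<inter> level E x0 n)"

lemma omega_eq: "omega E x0 n f e = f (vtx n e)"
  by (simp add: omega_def vtx_def)

lemma lev_ray:
  assumes "z 0 = x0" "\<forall>n. z (Suc n) \<in> ch (z n)"
  shows "lev (z n) = n"
proof (induction n)
  case (Suc n)
  then show ?case using lev_child[of "z (Suc n)" "z n"] assms(2) by simp
qed (simp add: assms(1))

lemma vtx_ray:
  assumes "z 0 = x0" "\<forall>n. z (Suc n) \<in> ch (z n)"
  shows "vtx n (range z) = z n"
  unfolding vtx_def level_def using lev_ray[OF assms] by (intro the_equality) auto

lemma vtx_0: "e \<in> bd \<Longrightarrow> vtx 0 e = x0"
  and vtx_Suc: "e \<in> bd \<Longrightarrow> vtx (Suc n) e \<in> ch (vtx n e)"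
  and lev_vtx: "e \<in> bd \<Longrightarrow> lev (vtx n e) = n"
  and mem_ray_iff: "e \<in> bd \<Longrightarrow> v \<in> e \<longleftrightarrow> vtx (lev v) e = v"
proof -
  have *: "\<exists>z. e = range z \<and> z 0 = x0 \<and> (\<forall>n. z (Suc n) \<in> ch (z n)) \<and>
      (\<forall>n. vtx n e = z n) \<and> (\<forall>n. lev (z n) = n)" if "e \<in> bd"
    using that vtx_ray lev_ray unfolding boundary_def by blast
  show "e \<in> bd \<Longrightarrow> vtx 0 e = x0" "e \<in> bd \<Longrightarrow> vtx (Suc n) e \<in> ch (vtx n e)"
      "e \<in> bd \<Longrightarrow> lev (vtx n e) = n"
    using * by metis+
  show "v \<in> e \<longleftrightarrow> vtx (lev v) e = v" if e: "e \<in> bd"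
  proof -
    from *[OF e] obtain z where "e = range z" "\<forall>n. vtx n e = z n" "\<forall>n. lev (z n) = n" by blast
    then show ?thesis by (metis rangeE rangeI)
  qed
qed

lemma parent_vtx: "e \<in> bd \<Longrightarrow> parent (vtx (Suc n) e) = vtx n e"
  by (rule parent_eq[OF vtx_Suc])

lemma mem_cyl_iff: "e \<in> cyl v \<longleftrightarrow> e \<in> bd \<and> vtx (lev v) e = v"
  by (auto simp: cylinder_def mem_ray_iff)

lemma cyl_root: "cyl x0 = bd"
  by (auto simp: mem_cyl_iff vtx_0)

lemma vtx_agree:
  assumes "e \<in> bd" "e' \<in> bd" "vtx n e = vtx n e'" "m \<le> n"
  shows "vtx m e = vtx m e'"
  using assms(4,3)
proof (induction rule: inc_induct)
  case (step k)
  then show ?case using parent_vtx[OF assms(1), of k] parent_vtx[OF assms(2), of k] by simp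
qed simp

text \<open>Two rays through the deeper vertex agree up to its level, so cylinders are nested or
  disjoint. Together with the empty set they thus form an intersection-stable generator.\<close>

lemma cyl_Int: "cyl u \<inter> cyl v \<in> {{}, cyl u, cyl v}"
proof -
  have *: "cyl u \<inter> cyl v \<in> {{}, cyl v}" if "lev u \<le> lev v" for u v
  proof (cases "cyl u \<inter> cyl v = {}")
    case False
    then obtain e where "e \<in> cyl u" "e \<in> cyl v" by blast
    then have "cyl v \<subseteq> cyl u"
      using vtx_agree[of _ e "lev v" "lev u"] that by (auto simp: mem_cyl_iff)
    then show ?thesis by blast
  qed simp
  show ?thesis using *[of u v] *[of v u] by (cases "lev u \<le> lev v") (auto simp: Int_commute)
qed

end

section \<open>The metric of convergence in probability\<close>

definition pnorm :: "'a measure \<Rightarrow> ('a \<Rightarrow> complex) \<Rightarrow> real" where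
  "pnorm M f = (\<integral>e. cmod (f e) / (1 + cmod (f e)) \<partial>M)"

lemma prob_dist_eq_pnorm: "prob_dist M f g = pnorm M (\<lambda>e. f e - g e)"
  by (simp add: prob_dist_def pnorm_def)

lemma frac_bounds:
  fixes t :: real
  assumes "0 \<le> t"
  shows "0 \<le> t / (1 + t)" "t / (1 + t) \<le> 1" "t / (1 + t) \<le> t"
  using assms by (auto simp: field_simps)

lemma norm_frac_le_1: "norm (cmod w / (1 + cmod w)) \<le> 1"
  using frac_bounds(1,2)[OF norm_ge_zero, of w] by simp

lemma frac_mono: "0 \<le> s \<Longrightarrow> s \<le> t \<Longrightarrow> s / (1 + s) \<le> t / (1 + (t::real))"
  by (simp add: field_simps)

lemma frac_add:
  fixes s t :: real
  assumes "0 \<le> s" "0 \<le> t"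
  shows "(s + t) / (1 + (s + t)) \<le> s / (1 + s) + t / (1 + t)"
proof -
  have "s / (1 + (s + t)) \<le> s / (1 + s)" "t / (1 + (s + t)) \<le> t / (1 + t)"
    using assms by (auto intro!: divide_left_mono mult_pos_pos)
  then show ?thesis by (simp add: add_divide_distrib)
qed

context prob_space
begin

lemma pnorm_integrable:
  assumes "f \<in> borel_measurable M"
  shows "integrable M (\<lambda>e. cmod (f e) / (1 + cmod (f e)))"
proof (rule integrable_const_bound[where B = 1])
  show "AE e in M. norm (cmod (f e) / (1 + cmod (f e))) \<le> 1"
    by (intro AE_I2 norm_frac_le_1)
qed (use assms in measurable)

lemma pnorm_mono:
  assumes "f \<in> borel_measurable M" "g \<in> borel_measurable M"
    and "AE e in M. cmod (f e) \<le> cmod (g e)"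
  shows "pnorm M f \<le> pnorm M g"
  unfolding pnorm_def
  by (intro integral_mono_AE pnorm_integrable assms(1,2) eventually_mono[OF assms(3)]
      frac_mono norm_ge_zero)

lemma pnorm_add:
  assumes [measurable]: "f \<in> borel_measurable M" "g \<in> borel_measurable M"
  shows "pnorm M (\<lambda>e. f e + g e) \<le> pnorm M f + pnorm M g"
proof -
  have "cmod (f e + g e) / (1 + cmod (f e + g e))
      \<le> cmod (f e) / (1 + cmod (f e)) + cmod (g e) / (1 + cmod (g e))" for e
    using frac_mono[OF norm_ge_zero norm_triangle_ineq, of "f e" "g e"]
      frac_add[of "cmod (f e)" "cmod (g e)"] by simp
  then have "pnorm M (\<lambda>e. f e + g e)
      \<le> (\<integral>e. cmod (f e) / (1 + cmod (f e)) + cmod (g e) / (1 + cmod (g e)) \<partial>M)"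
    unfolding pnorm_def by (intro integral_mono Bochner_Integration.integrable_add pnorm_integrable) auto
  then show ?thesis
    unfolding pnorm_def using pnorm_integrable[OF assms(1)] pnorm_integrable[OF assms(2)] by simp
qed

text \<open>A substitute for homogeneity, which \<open>pnorm\<close> lacks. The factor serves small
  and large \<open>c\<close> alike, and it can be divided by.\<close>

lemma pnorm_scale:
  assumes [measurable]: "f \<in> borel_measurable M"
  shows "pnorm M (\<lambda>e. c * f e) \<le> (1 + cmod c) * pnorm M f"
proof -
  have "cmod (c * f e) / (1 + cmod (c * f e)) \<le> (1 + cmod c) * (cmod (f e) / (1 + cmod (f e)))" for e
  proof -
    have "s * t / (1 + s * t) \<le> (1 + s) * (t / (1 + t))" if "0 \<le> s" "0 \<le> t" for s t :: real
    proof -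
      \<comment> \<open>Expanded, the right side exceeds the left by
        \<open>t + s * s * t * t\<close>.\<close>
      have "s * t * (1 + t) \<le> (1 + s) * t * (1 + s * t)"
        using that by (simp add: algebra_simps mult_mono)
      moreover have "0 < 1 + s * t" "0 < 1 + t" using that by (auto simp: add_pos_nonneg)
      ultimately show ?thesis by (simp add: field_simps)
    qed
    then show ?thesis by (simp add: norm_mult)
  qed
  then have "pnorm M (\<lambda>e. c * f e) \<le> (\<integral>e. (1 + cmod c) * (cmod (f e) / (1 + cmod (f e))) \<partial>M)"
    unfolding pnorm_def by (intro integral_mono integrable_mult_right pnorm_integrable) auto
  also have "\<dots> = (1 + cmod c) * pnorm M f"
    unfolding pnorm_def by (rule integral_mult_right_zero)
  finally show ?thesis .
qed

lemma pnorm_le_bound: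
  assumes "f \<in> borel_measurable M" "\<And>e. cmod (f e) \<le> B"
  shows "pnorm M f \<le> B"
proof -
  have "cmod (f e) / (1 + cmod (f e)) \<le> B" for e
    using frac_bounds(3)[of "cmod (f e)"] assms(2)[of e] by simp
  then show ?thesis unfolding pnorm_def
    by (intro integral_le_const pnorm_integrable assms(1)) auto
qed

text \<open>The integrand never exceeds 1, so the size of \<open>f\<close> on the exceptional set
  \<open>A\<close> does not matter.\<close>

lemma pnorm_le_prob:
  assumes "f \<in> borel_measurable M" "A \<in> events" "\<And>e. e \<in> space M - A \<Longrightarrow> f e = 0"
  shows "pnorm M f \<le> prob A"
proof -
  have "pnorm M f \<le> (\<integral>e. indicator A e \<partial>M)"
    unfolding pnorm_def
  proof (rule integral_mono[OF pnorm_integrable[OF assms(1)]])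
    show "integrable M (indicator A :: _ \<Rightarrow> real)"
      using assms(2) by (simp add: emeasure_eq_measure)
    show "cmod (f e) / (1 + cmod (f e)) \<le> indicator A e" if "e \<in> space M" for e
      using that assms(3) frac_bounds(2)[OF norm_ge_zero, of "f e"] by (cases "e \<in> A") auto
  qed
  then show ?thesis using assms(2) by simp
qed

lemma pnorm_tendsto_0:
  assumes "\<And>n. f n \<in> borel_measurable M"
    and "\<And>e. e \<in> space M \<Longrightarrow> (\<lambda>n. f n e) \<longlonglongrightarrow> 0"
  shows "(\<lambda>n. pnorm M (f n)) \<longlonglongrightarrow> 0"
proof -
  have "(\<lambda>n. pnorm M (f n)) \<longlonglongrightarrow> (\<integral>e. 0 \<partial>M)"
    unfolding pnorm_def
  proof (rule integral_dominated_convergence[where w = "\<lambda>_. 1"])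
    have "(\<lambda>n. cmod (f n e) / (1 + cmod (f n e))) \<longlonglongrightarrow> 0 / (1 + 0)" if "e \<in> space M" for e
      using assms(2)[OF that] by (intro tendsto_intros tendsto_norm_zero) auto
    then show "AE e in M. (\<lambda>n. cmod (f n e) / (1 + cmod (f n e))) \<longlonglongrightarrow> 0" by simp
    show "(\<lambda>e. cmod (f n e) / (1 + cmod (f n e))) \<in> borel_measurable M" for n
      using pnorm_integrable[OF assms(1)] by (rule borel_measurable_integrable)
    show "AE e in M. norm (cmod (f n e) / (1 + cmod (f n e))) \<le> 1" for n
      by (intro AE_I2 norm_frac_le_1)
  qed auto
  then show ?thesis by simp
qed

lemma pnorm_lim:
  assumes "\<And>n. f n \<in> borel_measurable M" "g \<in> borel_measurable M"
    and "\<And>e. e \<in> space M \<Longrightarrow> (\<lambda>n. f n e) \<longlonglongrightarrow> g e"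
    and "0 < \<epsilon>"
  shows "\<exists>n. pnorm M (\<lambda>e. g e - f n e) < \<epsilon>"
proof -
  have "(\<lambda>n. g e - f n e) \<longlonglongrightarrow> 0" if "e \<in> space M" for e
    using tendsto_diff[OF tendsto_const assms(3)[OF that], of "g e"] by simp
  then have "(\<lambda>n. pnorm M (\<lambda>e. g e - f n e)) \<longlonglongrightarrow> 0"
    using assms(1,2) by (intro pnorm_tendsto_0 borel_measurable_diff)
  then show ?thesis
    using order_tendstoD(2)[OF _ \<open>0 < \<epsilon>\<close>] eventually_happens'[OF sequentially_bot] by blast
qed

end

section \<open>Pointwise distance and an enumeration with repetitions\<close>

lemma sum_fun_apply: "(\<Sum>i\<in>S. f i) v = (\<Sum>i\<in>S. f i v :: 'b :: comm_monoid_add)"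
  by (induction S rule: infinite_finite_induct) auto

text \<open>The first \<open>K\<close> summands vanish, and the others are dominated by the tail of
  the geometric series.\<close>

lemma pointwise_dist_le:
  assumes "\<And>n. n < K \<Longrightarrow> f (z n) = g (z n)"
  shows "pointwise_dist z f g \<le> (1 / 2) ^ K"
proof -
  define t where
    "t = (\<lambda>n. (1 / 2) ^ Suc n * (cmod (f (z n) - g (z n)) / (1 + cmod (f (z n) - g (z n)))))"
  have geo: "(\<lambda>n. (1 / 2 :: real) ^ Suc (n + K)) sums (1 / 2) ^ K"
    using sums_mult[OF power_half_series, of "(1 / 2) ^ K"] by (simp add: power_add mult_ac)
  have t_le: "0 \<le> t n" "t n \<le> (1 / 2) ^ Suc n" for n
    unfolding t_def using frac_bounds(1,2)[OF norm_ge_zero, of "f (z n) - g (z n)"]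
    by (intro mult_nonneg_nonneg mult_left_le zero_le_power; simp)+
  have t_summable: "summable t"
    using t_le by (intro summable_comparison_test'[OF sums_summable[OF power_half_series], of 0 t])
      (simp del: power_Suc)
  have "pointwise_dist z f g = suminf t" by (simp only: pointwise_dist_def t_def)
  also have "\<dots> = (\<Sum>n. t (n + K)) + (\<Sum>n<K. t n)"
    by (rule suminf_split_initial_segment[OF t_summable])
  also have "(\<Sum>n<K. t n) = 0" using assms by (intro sum.neutral) (auto simp: t_def)
  also have "(\<Sum>n. t (n + K)) + 0 \<le> (\<Sum>n. (1 / 2) ^ Suc (n + K))"
    using t_le t_summable sums_summable[OF geo] by (simp add: suminf_le summable_iff_shift)
  also have "\<dots> = (1 / 2) ^ K" using geo by (rule sums_unique[symmetric])
  finally show ?thesis .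
qed

text \<open>Stage \<open>prod_encode (n, J)\<close> lists the \<open>n\<close>-th element of
  \<open>A\<close>. For fixed \<open>n\<close> this stage is at least \<open>J\<close>, so the
  element recurs beyond every bound.\<close>

lemma infinitely_often_enumeration:
  assumes "countable A" "A \<noteq> {}"
  shows "\<exists>\<tau> :: nat \<Rightarrow> 'a. \<forall>x\<in>A. \<forall>J. \<exists>j\<ge>J. \<tau> j = x"
proof (intro exI[of _ "from_nat_into A \<circ> fst \<circ> prod_decode"] ballI allI)
  fix x J assume "x \<in> A"
  then obtain n where "from_nat_into A n = x" using assms from_nat_into_surj by metis
  then show "\<exists>j\<ge>J. (from_nat_into A \<circ> fst \<circ> prod_decode) j = x"
    using le_prod_encode_2[of J n] by (intro exI[of _ "prod_encode (n, J)"]) simp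
qed

section \<open>The boundary measure and its cylinders\<close>

locale boundary_walk = rooted_tree E x0 + prob_space P
  for E :: "'v \<Rightarrow> 'v \<Rightarrow> bool" and x0 :: 'v and P :: "'v set measure" +
  fixes q :: "'v \<Rightarrow> 'v \<Rightarrow> real"
  assumes finite_level: "\<And>n. finite (level E x0 n)"
    and card_children: "\<And>x. 2 \<le> card (children E x0 x)"
    and q_pos: "\<And>x y. y \<in> children E x0 x \<Longrightarrow> 0 < q x y"
    and q_sum: "\<And>x. (\<Sum>y\<in>children E x0 x. q x y) = 1"
    and space_P: "space P = boundary E x0"
    and sets_P: "sets P = sigma_sets (boundary E x0) (\<Union>n\<in>{1..}. level_algebra E x0 n)"
    and prob_path: "\<And>n y. 1 \<le> n \<Longrightarrow> y 0 = x0 \<and> (\<forall>j<n. y (Suc j) \<in> children E x0 (y j)) \<Longrightarrow>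
             measure P (cylinder E x0 (y n)) = (\<Prod>j<n. q (y j) (y (Suc j)))"
begin

abbreviation M :: "'v set measure" where "M \<equiv> completion P"

sublocale M: prob_space M
  by (rule prob_space_completion)

lemma space_M: "space M = bd"
  by (simp add: space_P)

lemma cyl_in_sets_P: "cyl v \<in> sets P"
proof (cases "v = x0")
  \<comment> \<open>The generating algebras start at level 1, so the cylinder of the root is
    obtained as the whole space.\<close>
  case True
  then show ?thesis using sets.top[of P] by (simp add: cyl_root space_P)
next
  case False
  then have "1 \<le> lev v" using lev_eq_0_iff[of v] by linarith
  moreover have "cyl v \<in> level_algebra E x0 (lev v)"
    unfolding level_algebra_def level_def by (intro sigma_sets.Basic) blast
  ultimately show ?thesis unfolding sets_P by (intro sigma_sets.Basic) auto
qed

lemma cyl_in_sets_M [measurable]: "cyl v \<in> sets M"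
  using cyl_in_sets_P by (rule sets_completionI_sets)

text \<open>Replaces the union of the level algebras by a generator to which \<open>cyl_Int\<close>
  applies.\<close>

lemma sets_P_eq: "sets P = sigma_sets bd (insert {} (range cyl))"
proof
  have "level_algebra E x0 n \<subseteq> sigma_sets bd (insert {} (range cyl))" for n
    unfolding level_algebra_def by (rule sigma_sets_mono') auto
  then show "sets P \<subseteq> sigma_sets bd (insert {} (range cyl))"
    unfolding sets_P by (intro sigma_sets_mono) blast
  show "sigma_sets bd (insert {} (range cyl)) \<subseteq> sets P"
    using sets.sigma_sets_subset[of "insert {} (range cyl)" P] cyl_in_sets_P
    by (auto simp: space_P)
qed

section \<open>Density of the cylinder functions in L0\<close>

text \<open>Lists, possibly with repeated vertices, turn addition into concatenation, and there are
  only countably many of them over a countable set of vertices and coefficients.\<close>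

definition cyl_fun :: "('v \<times> complex) list \<Rightarrow> 'v set \<Rightarrow> complex" where
  "cyl_fun L e = (\<Sum>(v, c)\<leftarrow>L. if v \<in> e then c else 0)"

lemma cyl_fun_Nil [simp]: "cyl_fun [] e = 0"
  and cyl_fun_Cons [simp]: "cyl_fun ((v, c) # L) e = (if v \<in> e then c else 0) + cyl_fun L e"
  and cyl_fun_append: "cyl_fun (L @ L') e = cyl_fun L e + cyl_fun L' e"
  by (simp_all add: cyl_fun_def)

lemma cyl_fun_scale: "cyl_fun (map (\<lambda>(v, d). (v, a * d)) L) e = a * cyl_fun L e"
  by (induction L) (auto simp: algebra_simps)

lemma borel_measurable_cyl [measurable]: "(\<lambda>e. if v \<in> e then c else 0 :: complex) \<in> borel_measurable M"
proof -
  have "(\<lambda>e. c * indicator (cyl v) e) \<in> borel_measurable M" by measurable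
  moreover have "(if v \<in> e then c else 0) = c * indicator (cyl v) e" if "e \<in> space M" for e
    using that by (simp add: space_P cylinder_def)
  ultimately show ?thesis by (subst measurable_cong) auto
qed

lemma borel_measurable_cyl_fun [measurable]: "cyl_fun L \<in> borel_measurable M"
proof (induction L)
  case Nil
  have "cyl_fun [] = (\<lambda>_. 0)" by auto
  then show ?case by simp
next
  case (Cons p L)
  then show ?case
    by (cases p) (auto simp: cyl_fun_def[abs_def] intro!: borel_measurable_add borel_measurable_cyl)
qed

definition approximable :: "('v set \<Rightarrow> complex) \<Rightarrow> bool" where
  "approximable \<psi> \<longleftrightarrow> \<psi> \<in> borel_measurable M \<and>
    (\<forall>\<epsilon>>0. \<exists>L. pnorm M (\<lambda>e. \<psi> e - cyl_fun L e) < \<epsilon>)"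

lemma approximable_cyl_fun: "approximable (cyl_fun L)"
  unfolding approximable_def by (auto intro!: exI[of _ L] simp: pnorm_def)

lemma approximable_limit:
  assumes "\<psi> \<in> borel_measurable M"
    and "\<And>\<epsilon>. 0 < \<epsilon> \<Longrightarrow> \<exists>\<phi>. approximable \<phi> \<and> pnorm M (\<lambda>e. \<psi> e - \<phi> e) < \<epsilon>"
  shows "approximable \<psi>"
  unfolding approximable_def
proof (intro conjI allI impI assms(1))
  fix \<epsilon> :: real assume "0 < \<epsilon>"
  then have "0 < \<epsilon> / 2" by simp
  then obtain \<phi> where \<phi>: "approximable \<phi>" "pnorm M (\<lambda>e. \<psi> e - \<phi> e) < \<epsilon> / 2"
    using assms(2) by blast
  then obtain L where L: "pnorm M (\<lambda>e. \<phi> e - cyl_fun L e) < \<epsilon> / 2"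
    using \<open>0 < \<epsilon> / 2\<close> unfolding approximable_def by blast
  have "\<phi> \<in> borel_measurable M" using \<phi>(1) by (simp add: approximable_def)
  then have "pnorm M (\<lambda>e. (\<psi> e - \<phi> e) + (\<phi> e - cyl_fun L e))
      \<le> pnorm M (\<lambda>e. \<psi> e - \<phi> e) + pnorm M (\<lambda>e. \<phi> e - cyl_fun L e)"
    using assms(1) by (intro M.pnorm_add) auto
  then show "\<exists>L. pnorm M (\<lambda>e. \<psi> e - cyl_fun L e) < \<epsilon>" using \<phi>(2) L by (auto intro!: exI[of _ L])
qed

text \<open>Absorbs the null sets added by the completion, and also formulas that agree only on the
  boundary.\<close>

lemma approximable_cong:
  assumes "approximable \<phi>" "\<psi> \<in> borel_measurable M" "AE e in M. \<psi> e = \<phi> e"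
  shows "approximable \<psi>"
proof (rule approximable_limit[OF assms(2)])
  have "pnorm M (\<lambda>e. \<psi> e - \<phi> e) \<le> pnorm M (\<lambda>_. 0)"
    using assms by (intro M.pnorm_mono) (auto simp: approximable_def)
  then show "\<exists>\<phi>. approximable \<phi> \<and> pnorm M (\<lambda>e. \<psi> e - \<phi> e) < \<epsilon>" if "0 < \<epsilon>" for \<epsilon>
    using assms(1) that by (intro exI[of _ \<phi>]) (simp add: pnorm_def)
qed

lemma approximable_add:
  assumes "approximable \<phi>" "approximable \<psi>"
  shows "approximable (\<lambda>e. \<phi> e + \<psi> e)"
  unfolding approximable_def
proof (intro conjI allI impI)
  have [measurable]: "\<phi> \<in> borel_measurable M" "\<psi> \<in> borel_measurable M"
    using assms by (auto simp: approximable_def)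
  show "(\<lambda>e. \<phi> e + \<psi> e) \<in> borel_measurable M" by measurable
  fix \<epsilon> :: real assume "0 < \<epsilon>"
  then have "0 < \<epsilon> / 2" by simp
  then obtain L K where L: "pnorm M (\<lambda>e. \<phi> e - cyl_fun L e) < \<epsilon> / 2"
      and K: "pnorm M (\<lambda>e. \<psi> e - cyl_fun K e) < \<epsilon> / 2"
    using assms unfolding approximable_def by blast
  have "pnorm M (\<lambda>e. (\<phi> e - cyl_fun L e) + (\<psi> e - cyl_fun K e))
      \<le> pnorm M (\<lambda>e. \<phi> e - cyl_fun L e) + pnorm M (\<lambda>e. \<psi> e - cyl_fun K e)"
    by (intro M.pnorm_add) auto
  then show "\<exists>L. pnorm M (\<lambda>e. (\<phi> e + \<psi> e) - cyl_fun L e) < \<epsilon>"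
    using L K by (intro exI[of _ "L @ K"]) (simp add: cyl_fun_append algebra_simps)
qed

lemma approximable_scale:
  assumes "approximable \<phi>"
  shows "approximable (\<lambda>e. c * \<phi> e)"
  unfolding approximable_def
proof (intro conjI allI impI)
  have [measurable]: "\<phi> \<in> borel_measurable M"
    using assms by (auto simp: approximable_def)
  show "(\<lambda>e. c * \<phi> e) \<in> borel_measurable M" by measurable
  fix \<epsilon> :: real assume "0 < \<epsilon>"
  have c: "0 < 1 + cmod c" by (simp add: add_pos_nonneg)
  with \<open>0 < \<epsilon>\<close> have "0 < \<epsilon> / (1 + cmod c)" by simp
  then obtain L where L: "pnorm M (\<lambda>e. \<phi> e - cyl_fun L e) < \<epsilon> / (1 + cmod c)"
    using assms unfolding approximable_def by blast
  have "pnorm M (\<lambda>e. c * (\<phi> e - cyl_fun L e)) \<le> (1 + cmod c) * pnorm M (\<lambda>e. \<phi> e - cyl_fun L e)"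
    by (intro M.pnorm_scale) auto
  also have "\<dots> < \<epsilon>" using L c by (simp add: field_simps)
  finally show "\<exists>L. pnorm M (\<lambda>e. c * \<phi> e - cyl_fun L e) < \<epsilon>"
    by (intro exI[of _ "map (\<lambda>(v, d). (v, c * d)) L"]) (simp add: cyl_fun_scale right_diff_distrib)
qed

lemma approximable_0: "approximable (\<lambda>_. 0)"
  using approximable_cyl_fun[of "[]"] by (simp add: cyl_fun_def[abs_def])

lemma approximable_sum:
  assumes "finite S" "\<And>i. i \<in> S \<Longrightarrow> approximable (f i)"
  shows "approximable (\<lambda>e. \<Sum>i\<in>S. f i e)"
  using assms by (induction S) (auto intro: approximable_0 approximable_add)

lemma approximable_pointwise_limit:
  assumes "\<And>n. approximable (f n)" "\<psi> \<in> borel_measurable M"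
    and "\<And>e. e \<in> bd \<Longrightarrow> (\<lambda>n. f n e) \<longlonglongrightarrow> \<psi> e"
  shows "approximable \<psi>"
proof (rule approximable_limit[OF assms(2)])
  fix \<epsilon> :: real assume "0 < \<epsilon>"
  moreover have "f n \<in> borel_measurable M" for n using assms(1) by (simp add: approximable_def)
  ultimately obtain n where "pnorm M (\<lambda>e. \<psi> e - f n e) < \<epsilon>"
    using M.pnorm_lim[of f \<psi> \<epsilon>] assms(2,3) by (auto simp: space_P)
  then show "\<exists>\<phi>. approximable \<phi> \<and> pnorm M (\<lambda>e. \<psi> e - \<phi> e) < \<epsilon>" using assms(1) by blast
qed

text \<open>Dynkin's argument: approximability holds on the intersection-stable generator and passes
  to complements and to countable disjoint unions, the latter by pointwise convergence of the
  partial sums of indicators.\<close>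

lemma approximable_indicator_P:
  assumes "A \<in> sets P"
  shows "approximable (indicator A)"
proof -
  have "Int_stable (insert {} (range cyl))"
    using cyl_Int by (fastforce intro!: Int_stableI)
  moreover have "insert {} (range cyl) \<subseteq> Pow bd" by (auto simp: cylinder_def)
  moreover have "A \<in> sigma_sets bd (insert {} (range cyl))" using assms sets_P_eq by simp
  ultimately show ?thesis
  proof (induction rule: sigma_sets_induct_disjoint)
    case (basic A)
    show ?case
    proof (cases "A = {}")
      case True
      then show ?thesis using approximable_0 by (simp add: indicator_def[abs_def])
    next
      case False
      then obtain v where A: "A = cyl v" using basic by auto
      show ?thesis unfolding A
      proof (rule approximable_cong[OF approximable_cyl_fun[of "[(v, 1)]"]])
        show "AE e in M. indicator (cyl v) e = cyl_fun [(v, 1)] e"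
          by (intro AE_I2) (simp add: indicator_def cylinder_def space_P)
      qed (intro borel_measurable_indicator cyl_in_sets_M)
    qed
  next
    case empty
    show ?case using approximable_0 by (simp add: indicator_def[abs_def])
  next
    case (compl A)
    then have "A \<in> sets M" using sets_P_eq by auto
    \<comment> \<open>Every geodesic contains the root, so \<open>cyl_fun [(x0, 1)]\<close> is the
      constant 1 on the boundary.\<close>
    have "approximable (\<lambda>e. cyl_fun [(x0, 1)] e + - 1 * indicator A e)"
      by (intro approximable_add approximable_scale approximable_cyl_fun compl)
    then show ?case
    proof (rule approximable_cong)
      have "bd - A \<in> sets M" using \<open>A \<in> sets M\<close> sets.compl_sets[of A M] by (simp add: space_P)
      then show "indicator (bd - A) \<in> borel_measurable M" by (rule borel_measurable_indicator)
      show "AE e in M. indicator (bd - A) e = cyl_fun [(x0, 1)] e + - 1 * indicator A e"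
      proof (rule AE_I2)
        fix e assume "e \<in> space M"
        then have "e \<in> bd" "x0 \<in> e" using cyl_root by (auto simp: space_P cylinder_def)
        then show "indicator (bd - A) e = cyl_fun [(x0, 1)] e + - 1 * indicator A e"
          by (simp add: indicator_def)
      qed
    qed
  next
    case (union A)
    then have A: "A i \<in> sets P" for i using sets_P_eq by auto
    show ?case
    proof (rule approximable_pointwise_limit)
      show "approximable (\<lambda>e. \<Sum>i<n. indicator (A i) e)" for n
        by (intro approximable_sum union) auto
      have "(\<Union>i. A i) \<in> sets M" using A by auto
      then show "indicator (\<Union>i. A i) \<in> borel_measurable M" by (rule borel_measurable_indicator)
      show "(\<lambda>n. \<Sum>i<n. indicator (A i) e) \<longlonglongrightarrow> (indicator (\<Union>i. A i) e :: complex)" for e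
      proof -
        have "(\<lambda>i. complex_of_real (indicator (A i) e)) sums of_real (indicator (\<Union>i. A i) e)"
          using union(1) by (intro sums_of_real indicator_sums) (auto simp: disjoint_family_on_def)
        moreover have "complex_of_real (indicator B e) = indicator B e" for B :: "'v set set"
          by (simp add: indicator_def)
        ultimately show ?thesis by (simp add: sums_def)
      qed
    qed
  qed
qed

text \<open>A set of the completion differs from its main part, which lies in \<open>sets P\<close>,
  by a null set.\<close>

lemma approximable_indicator:
  assumes "A \<in> sets M"
  shows "approximable (indicator A)"
proof (rule approximable_cong[OF approximable_indicator_P])
  show "main_part P A \<in> sets P" using assms by (rule main_part_sets)
  show "indicator A \<in> borel_measurable M" using assms by simp
  have "null_part P A \<in> null_sets M" using null_part[OF assms] null_sets_completion_iff2 by blast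
  then have "AE e in M. e \<notin> null_part P A" by (rule AE_not_in)
  then show "AE e in M. indicator A e = (indicator (main_part P A) e :: complex)"
    using main_part_null_part_Un[OF assms] by (auto elim!: eventually_mono simp: indicator_def)
qed

lemma approximable_borel_measurable:
  assumes "\<psi> \<in> borel_measurable M"
  shows "approximable \<psi>"
proof -
  obtain F where F: "\<And>i. simple_function M (F i)"
      "\<And>e. e \<in> space M \<Longrightarrow> (\<lambda>i. F i e) \<longlonglongrightarrow> \<psi> e"
    using borel_measurable_implies_sequence_metric[OF assms, of 0] by blast
  have "approximable (F i)" for i
  proof (rule approximable_cong)
    have fin: "finite (F i ` space M)" using F(1)[of i] by (rule simple_functionD)
    show "approximable (\<lambda>e. \<Sum>y\<in>F i ` space M. y * indicator (F i -` {y} \<inter> space M) e)"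
      using F(1)[of i]
      by (intro approximable_sum fin approximable_scale approximable_indicator simple_functionD(2))
    show "F i \<in> borel_measurable M" using F(1) by (rule borel_measurable_simple_function)
    show "AE e in M. F i e = (\<Sum>y\<in>F i ` space M. y * indicator (F i -` {y} \<inter> space M) e)"
    proof (rule AE_I2)
      fix e assume e: "e \<in> space M"
      then have "(\<Sum>y\<in>F i ` space M. y * indicator (F i -` {y} \<inter> space M) e)
          = (\<Sum>y\<in>F i ` space M. if y = F i e then F i e else 0)"
        by (intro sum.cong) (auto simp: indicator_def)
      then show "F i e = (\<Sum>y\<in>F i ` space M. y * indicator (F i -` {y} \<inter> space M) e)"
        using e fin by simp
    qed
  qed
  then show ?thesis
    by (rule approximable_pointwise_limit[OF _ assms F(2)]) (simp add: space_P)
qed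

text \<open>Moving the finitely many coefficients into \<open>D\<close> changes a cylinder function
  by a uniformly small amount, which bounds \<open>pnorm\<close>. A countable \<open>D\<close> then
  leaves only countably many tasks.\<close>

lemma cyl_fun_dense:
  assumes D: "\<And>U. open U \<Longrightarrow> U \<noteq> {} \<Longrightarrow> \<exists>d\<in>D. d \<in> U"
    and "\<psi> \<in> borel_measurable M" "0 < \<epsilon>"
  shows "\<exists>L\<in>lists (UNIV \<times> D). pnorm M (\<lambda>e. \<psi> e - cyl_fun L e) < \<epsilon>"
proof -
  \<comment> \<open>One half of the admissible error is spent on the head of the list, the other
    half on its tail.\<close>
  have *: "\<exists>K\<in>lists (UNIV \<times> D). \<forall>e. cmod (cyl_fun L e - cyl_fun K e) \<le> \<delta>" if "0 < \<delta>" for L \<delta>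
    using that
  proof (induction L arbitrary: \<delta>)
    case Nil
    then show ?case by (intro bexI[of _ "[]"]) auto
  next
    case (Cons p L)
    obtain v c where p: "p = (v, c)" by force
    obtain K where K: "K \<in> lists (UNIV \<times> D)" "\<And>e. cmod (cyl_fun L e - cyl_fun K e) \<le> \<delta> / 2"
      using Cons.IH[of "\<delta> / 2"] Cons.prems half_gt_zero by blast
    obtain d where d: "d \<in> D" "dist c d < \<delta> / 2"
      using D[of "ball c (\<delta> / 2)"] Cons.prems by auto
    show ?case
    proof (intro bexI[of _ "(v, d) # K"] allI)
      fix e
      have "cmod ((if v \<in> e then c else 0) - (if v \<in> e then d else 0)) \<le> \<delta> / 2"
        using d(2) Cons.prems by (simp add: dist_norm)
      then have "cmod (((if v \<in> e then c else 0) - (if v \<in> e then d else 0)) + (cyl_fun L e - cyl_fun K e)) \<le> \<delta>"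
        using K(2)[of e] by (intro norm_triangle_le) linarith
      then show "cmod (cyl_fun (p # L) e - cyl_fun ((v, d) # K) e) \<le> \<delta>"
        by (simp add: p algebra_simps)
    qed (use K d in auto)
  qed
  have "0 < \<epsilon> / 2" using assms(3) by simp
  then obtain L where L: "pnorm M (\<lambda>e. \<psi> e - cyl_fun L e) < \<epsilon> / 2"
    using approximable_borel_measurable[OF assms(2)] unfolding approximable_def by blast
  obtain K where K: "K \<in> lists (UNIV \<times> D)" "\<forall>e. cmod (cyl_fun L e - cyl_fun K e) \<le> \<epsilon> / 2"
    using *[OF \<open>0 < \<epsilon> / 2\<close>] by blast
  have "pnorm M (\<lambda>e. (\<psi> e - cyl_fun L e) + (cyl_fun L e - cyl_fun K e))
      \<le> pnorm M (\<lambda>e. \<psi> e - cyl_fun L e) + pnorm M (\<lambda>e. cyl_fun L e - cyl_fun K e)"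
    using assms(2) by (intro M.pnorm_add) auto
  moreover have "pnorm M (\<lambda>e. cyl_fun L e - cyl_fun K e) \<le> \<epsilon> / 2"
    using K(2) by (intro M.pnorm_le_bound) auto
  ultimately show ?thesis using L K(1) by (intro bexI[of _ K]) auto
qed

section \<open>Sinks, and harmonic functions prescribed off the sinks\<close>

lemma finite_children [simp]: "finite (ch x)"
  using card_children[of x] by (intro card_ge_0_finite) linarith

definition sink :: "'v \<Rightarrow> 'v" where
  "sink x = (SOME y. y \<in> ch x \<and> q x y \<le> 1 / 2)"

text \<open>Among two distinct children, whose weights sum to at most 1, one has weight at most
  1/2.\<close>

lemma sink_child: "sink x \<in> ch x"
  and q_sink_le: "q x (sink x) \<le> 1 / 2"
proof -
  obtain A where A: "A \<subseteq> ch x" "card A = 2"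
    using obtain_subset_with_card_n[OF card_children] by blast
  then obtain a b where ab: "A = {a, b}" "a \<noteq> b" by (auto simp: card_2_iff)
  have "(\<Sum>y\<in>A. q x y) \<le> (\<Sum>y\<in>ch x. q x y)"
    using A q_pos by (intro sum_mono2) (auto intro: less_imp_le)
  then have "q x a + q x b \<le> 1" using ab q_sum by simp
  then have "q x a \<le> 1 / 2 \<or> q x b \<le> 1 / 2" by linarith
  then have "\<exists>y. y \<in> ch x \<and> q x y \<le> 1 / 2" using A ab by auto
  from someI_ex[OF this] show "sink x \<in> ch x" "q x (sink x) \<le> 1 / 2"
    by (auto simp: sink_def)
qed

text \<open>The vertices whose values can be prescribed. The root is listed separately, since
  \<open>parent x0\<close> is an unspecified vertex.\<close>

definition free :: "'v \<Rightarrow> bool" where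
  "free y \<longleftrightarrow> y = x0 \<or> y \<noteq> sink (parent y)"

lemma parent_sink [simp]: "parent (sink x) = x"
  by (rule parent_eq[OF sink_child])

lemma free_child: "y \<in> ch x \<Longrightarrow> free y \<longleftrightarrow> y \<noteq> sink x"
  using parent_eq root_not_child by (auto simp: free_def)

text \<open>The sink has nonzero weight, so the weighted sum over the children can be solved for its
  value. Neither function need be harmonic elsewhere, so \<open>g\<close> may be a constant.\<close>

lemma sink_value_unique:
  fixes f g :: "'v \<Rightarrow> complex"
  assumes "(\<Sum>y\<in>ch x. of_real (q x y) * f y) = (\<Sum>y\<in>ch x. of_real (q x y) * g y)"
    and "\<And>y. y \<in> ch x \<Longrightarrow> free y \<Longrightarrow> f y = g y"
  shows "f (sink x) = g (sink x)"
proof -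
  have split: "(\<Sum>y\<in>ch x. of_real (q x y) * h y) =
      of_real (q x (sink x)) * h (sink x) + (\<Sum>y\<in>ch x - {sink x}. of_real (q x y) * h y)"
    for h :: "'v \<Rightarrow> complex"
    by (intro sum.remove sink_child) simp
  have "(\<Sum>y\<in>ch x - {sink x}. of_real (q x y) * f y) = (\<Sum>y\<in>ch x - {sink x}. of_real (q x y) * g y)"
    using assms(2) free_child by (intro sum.cong) auto
  moreover have "q x (sink x) \<noteq> 0" using q_pos[OF sink_child, of x] by simp
  ultimately show ?thesis using assms(1) unfolding split by simp
qed

abbreviation H :: "('v \<Rightarrow> complex) set" where "H \<equiv> harmonic E x0 q"

lemma harmonicD: "f \<in> H \<Longrightarrow> f x = (\<Sum>y\<in>ch x. of_real (q x y) * f y)"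
  unfolding harmonic_def by blast

lemma subspace_harmonic: "complex_fun.subspace H"
proof (rule complex_fun.subspaceI)
  show "0 \<in> H" by (simp add: harmonic_def)
  show "f + g \<in> H" if "f \<in> H" "g \<in> H" for f g
    unfolding harmonic_def
  proof (intro CollectI allI)
    show "(f + g) x = (\<Sum>y\<in>ch x. of_real (q x y) * (f + g) y)" for x
      using harmonicD[OF that(1), of x] harmonicD[OF that(2), of x]
      by (simp add: distrib_left sum.distrib del: of_real_mult)
  qed
  show "(\<lambda>x. c * f x) \<in> H" if "f \<in> H" for c f
    unfolding harmonic_def
  proof (intro CollectI allI)
    show "c * f x = (\<Sum>y\<in>ch x. of_real (q x y) * (c * f y))" for x
      using arg_cong[OF harmonicD[OF that, of x], of "(*) c"]
      by (simp add: sum_distrib_left mult.left_commute)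
  qed
qed

text \<open>Induction on the level: the value at a sink is determined by the value at its parent and
  those at its siblings, all of which are free.\<close>

lemma harmonic_agree:
  assumes "f \<in> H" "g \<in> H"
    and "\<And>v. free v \<Longrightarrow> lev v \<le> N \<Longrightarrow> f v = g v"
    and "lev v \<le> N"
  shows "f v = g v"
  using assms(4)
proof (induction "lev v" arbitrary: v rule: less_induct)
  case less
  show ?case
  proof (cases "free v")
    case False
    define x where "x = parent v"
    have v: "v = sink x" "v \<in> ch x"
      using False child_parent by (auto simp: free_def x_def)
    have l: "lev v = Suc (lev x)" by (rule lev_child[OF v(2)])
    have "f x = g x" using less.hyps[of x] less.prems l by simp
    then have "(\<Sum>y\<in>ch x. of_real (q x y) * f y) = (\<Sum>y\<in>ch x. of_real (q x y) * g y)"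
      using harmonicD[OF assms(1), of x] harmonicD[OF assms(2), of x] by (simp only:)
    moreover have "f y = g y" if "y \<in> ch x" "free y" for y
      using assms(3)[OF that(2)] lev_child[OF that(1)] less.prems l by linarith
    ultimately show ?thesis unfolding v(1) by (rule sink_value_unique)
  qed (use assms(3) less.prems in auto)
qed

text \<open>The numerical argument is the level of \<open>y\<close>, so that passing to the parent
  becomes primitive recursion. At a sink the harmonicity equation of the parent is solved for the
  value; its siblings are free, so their values are those of \<open>t\<close>.\<close>

primrec extend_upto :: "('v \<Rightarrow> complex) \<Rightarrow> nat \<Rightarrow> 'v \<Rightarrow> complex" where
  "extend_upto t 0 y = t y"
| "extend_upto t (Suc n) y = (if free y then t y else
    (extend_upto t n (parent y) - (\<Sum>w\<in>ch (parent y) - {y}. of_real (q (parent y) w) * t w))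
      / of_real (q (parent y) y))"

definition extend :: "('v \<Rightarrow> complex) \<Rightarrow> 'v \<Rightarrow> complex" where
  "extend t y = extend_upto t (lev y) y"

lemma extend_free: "free y \<Longrightarrow> extend t y = t y"
  by (cases "lev y") (auto simp: extend_def)

lemma extend_harmonic: "extend t \<in> H"
  unfolding harmonic_def
proof (intro CollectI allI)
  fix x
  define s where "s = sink x"
  have s: "s \<in> ch x" "parent s = x" "\<not> free s"
    using sink_child free_child by (auto simp: s_def)
  have "q x s \<noteq> 0" using q_pos[OF s(1)] by simp
  then have "of_real (q x s) * extend t s = extend t x - (\<Sum>w\<in>ch x - {s}. of_real (q x w) * t w)"
    using s lev_child[OF s(1)] by (simp add: extend_def)
  moreover have "(\<Sum>w\<in>ch x - {s}. of_real (q x w) * t w) = (\<Sum>w\<in>ch x - {s}. of_real (q x w) * extend t w)"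
    using free_child extend_free by (intro sum.cong) (auto simp: s_def)
  moreover have "(\<Sum>y\<in>ch x. of_real (q x y) * extend t y) =
      of_real (q x s) * extend t s + (\<Sum>w\<in>ch x - {s}. of_real (q x w) * extend t w)"
    using s(1) by (intro sum.remove) auto
  ultimately show "extend t x = (\<Sum>y\<in>ch x. of_real (q x y) * extend t y)" by simp
qed

section \<open>Rays that follow sinks for many steps\<close>

text \<open>Compares the products along a path to \<open>x\<close> and along its prolongation by
  \<open>y\<close>. Both paths must have length at least 1 for \<open>prob_path\<close>, hence
  \<open>x\<close> is not the root.\<close>

lemma prob_cyl_child:
  assumes "y \<in> ch x" "x \<noteq> x0"
  shows "prob (cyl y) = q x y * prob (cyl x)"
proof -
  obtain p where p: "p 0 = x0" "p (lev x) = x" "\<forall>j<lev x. p (Suc j) \<in> ch (p j)"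
    using ex_root_path by blast
  define r where "r = p(Suc (lev x) := y)"
  have l: "1 \<le> lev x" using assms(2) lev_eq_0_iff[of x] by linarith
  have "prob (cyl (p (lev x))) = (\<Prod>j<lev x. q (p j) (p (Suc j)))"
    using p l by (intro prob_path) auto
  moreover have "prob (cyl (r (Suc (lev x)))) = (\<Prod>j<Suc (lev x). q (r j) (r (Suc j)))"
    using p l assms(1) by (intro prob_path) (auto simp: r_def less_Suc_eq)
  moreover have "(\<Prod>j<lev x. q (r j) (r (Suc j))) = (\<Prod>j<lev x. q (p j) (p (Suc j)))"
    by (intro prod.cong) (auto simp: r_def)
  ultimately show ?thesis using p by (simp add: r_def)
qed

lemma lev_sink_iter: "lev ((sink ^^ k) w) = lev w + k"
  by (induction k) (auto simp: lev_child[OF sink_child])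

lemma prob_sink_iter:
  assumes "w \<noteq> x0"
  shows "prob (cyl ((sink ^^ k) w)) \<le> (1 / 2) ^ k * prob (cyl w)"
proof (induction k)
  case (Suc k)
  have "lev w \<noteq> 0" using assms by simp
  then have "lev ((sink ^^ k) w) \<noteq> 0" unfolding lev_sink_iter by linarith
  then have "(sink ^^ k) w \<noteq> x0" by simp
  then have "prob (cyl ((sink ^^ Suc k) w)) = q ((sink ^^ k) w) (sink ((sink ^^ k) w)) * prob (cyl ((sink ^^ k) w))"
    using prob_cyl_child[OF sink_child] by simp
  also have "\<dots> \<le> 1 / 2 * ((1 / 2) ^ k * prob (cyl w))"
    using Suc q_sink_le by (intro mult_mono) auto
  finally show ?case by simp
qed simp

text \<open>The rays that enter a sink at each of the \<open>k\<close> steps following level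
  \<open>a\<close>. This is the exceptional set on which nothing is known about the values of the
  constructed functions.\<close>

definition trapped :: "nat \<Rightarrow> nat \<Rightarrow> 'v set set" where
  "trapped a k = (\<Union>w\<in>level E x0 a. cyl ((sink ^^ k) w))"

lemma trapped_in_sets_P: "trapped a k \<in> sets P"
  unfolding trapped_def using finite_level cyl_in_sets_P by auto

text \<open>The cylinders of one level are disjoint, so their probabilities sum to at most 1, and
  following sinks for \<open>k\<close> steps shrinks each of them by the factor
  \<open>(1 / 2) ^ k\<close>. As \<open>0 < a\<close>, the root is not among the starting
  vertices.\<close>

lemma prob_trapped:
  assumes "0 < a"
  shows "prob (trapped a k) \<le> (1 / 2) ^ k"
proof -
  have "(\<Sum>w\<in>level E x0 a. prob (cyl w)) = prob (\<Union>w\<in>level E x0 a. cyl w)"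
    using finite_level cyl_in_sets_P
    by (intro finite_measure_finite_Union[symmetric])
      (auto simp: disjoint_family_on_def level_def mem_cyl_iff)
  then have total: "(\<Sum>w\<in>level E x0 a. prob (cyl w)) \<le> 1" by simp
  have "prob (trapped a k) \<le> (\<Sum>w\<in>level E x0 a. prob (cyl ((sink ^^ k) w)))"
    unfolding trapped_def using finite_level cyl_in_sets_P
    by (intro finite_measure_subadditive_finite) auto
  also have "\<dots> \<le> (\<Sum>w\<in>level E x0 a. (1 / 2) ^ k * prob (cyl w))"
    using assms by (intro sum_mono prob_sink_iter) (auto simp: level_def)
  also have "\<dots> \<le> (1 / 2) ^ k"
    using mult_left_mono[OF total, of "(1 / 2) ^ k"] by (simp add: sum_distrib_left)
  finally show ?thesis .
qed

text \<open>Otherwise each of the \<open>k\<close> vertices after level \<open>a\<close> is the sink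
  of its predecessor, and the ray is trapped.\<close>

lemma ex_free_vertex:
  assumes "e \<in> bd" "e \<notin> trapped a k"
  shows "\<exists>l. a \<le> l \<and> l < a + k \<and> free (vtx (Suc l) e)"
proof (rule ccontr)
  assume *: "\<not> ?thesis"
  have "vtx (a + i) e = (sink ^^ i) (vtx a e)" if "i \<le> k" for i
    using that
  proof (induction i)
    case (Suc i)
    then have "\<not> free (vtx (Suc (a + i)) e)" using * by auto
    then have "vtx (Suc (a + i)) e = sink (vtx (a + i) e)"
      using free_child[OF vtx_Suc[OF assms(1)]] by simp
    then show ?case using Suc by simp
  qed simp
  then have "e \<in> cyl ((sink ^^ k) (vtx a e))"
    using assms(1) by (simp add: mem_cyl_iff lev_sink_iter lev_vtx)
  then show False using assms lev_vtx by (auto simp: trapped_def level_def)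
qed

section \<open>The family of harmonic functions and its values at the end of a block\<close>

text \<open>
  The cylinder function of a task is evaluated along a ray through the parent of \<open>y\<close>, so that all
  the children of a vertex visibly receive the same value.
\<close>

definition target :: "(nat \<Rightarrow> ('v \<times> bool) \<times> ('v \<times> complex) list) \<Rightarrow> 'v \<times> bool \<Rightarrow> 'v \<Rightarrow> complex" where
  "target \<tau> i y =
    (if lev y < lev (fst i) then 0
     else if lev y = lev (fst i) then of_bool (y = fst i)
     else if fst (\<tau> (floor_log (lev y))) = i
       then cyl_fun (snd (\<tau> (floor_log (lev y)))) (SOME e. e \<in> cyl (parent y))
     else 0)"

definition fam :: "(nat \<Rightarrow> ('v \<times> bool) \<times> ('v \<times> complex) list) \<Rightarrow> 'v \<times> bool \<Rightarrow> 'v \<Rightarrow> complex" where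
  "fam \<tau> i = extend (target \<tau> i)"

lemma fam_harmonic: "fam \<tau> i \<in> H"
  unfolding fam_def by (rule extend_harmonic)

lemma fam_free: "free v \<Longrightarrow> fam \<tau> i v = target \<tau> i v"
  unfolding fam_def by (rule extend_free)

lemma fam_below: "lev v < lev (fst i) \<Longrightarrow> fam \<tau> i v = 0"
  using harmonic_agree[OF fam_harmonic complex_fun.subspace_0[OF subspace_harmonic], where N = "lev v" and v = v]
    fam_free[of _ \<tau> i] by (auto simp: target_def)

text \<open>The ray selected in \<open>target\<close> agrees with \<open>e\<close> up to level
  \<open>l\<close>, and the vertices in \<open>L\<close> have level at most
  \<open>2 ^ j \<le> l\<close>, so both rays give \<open>cyl_fun L\<close> the same value. The bound
  on \<open>Suc l\<close> keeps the child \<open>w\<close> in block \<open>j\<close>.\<close>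

lemma target_in_block:
  assumes "e \<in> bd" "\<tau> j = (k, L)" "lev (fst i) < 2 ^ j" "\<forall>p\<in>set L. lev (fst p) \<le> 2 ^ j"
    and "2 ^ j \<le> l" "Suc l < 2 * 2 ^ j" "w \<in> ch (vtx l e)"
  shows "target \<tau> i w = (if k = i then cyl_fun L e else 0)"
proof -
  have lw: "lev w = Suc l" using lev_child[OF assms(7)] lev_vtx[OF assms(1)] by simp
  have fl: "floor_log (Suc l) = j" using assms(5,6) by (intro floor_log_eqI) simp_all
  define e' where "e' = (SOME e'. e' \<in> cyl (vtx l e))"
  have "e \<in> cyl (vtx l e)" using assms(1) by (simp add: mem_cyl_iff lev_vtx)
  then have "e' \<in> cyl (vtx l e)" unfolding e'_def by (rule someI)
  then have e': "e' \<in> bd" "vtx l e' = vtx l e" using assms(1) by (auto simp: mem_cyl_iff lev_vtx)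
  have "v \<in> e' \<longleftrightarrow> v \<in> e" if "(v, c) \<in> set L" for v c
    using vtx_agree[OF e'(1) assms(1) e'(2), of "lev v"] assms(4,5) that
    by (force simp add: mem_ray_iff assms(1) e'(1))
  then have "cyl_fun L e' = cyl_fun L e"
    unfolding cyl_fun_def by (intro arg_cong[where f = sum_list] map_cong) auto
  then show ?thesis
    using lw fl assms(2,3,5) parent_eq[OF assms(7)] by (auto simp: target_def e'_def)
qed

text \<open>An untrapped ray meets a free vertex in the block, where the prescribed value
  \<open>c\<close> is attained. From there it propagates: if the value at a vertex and at its free
  children is \<open>c\<close>, then it is \<open>c\<close> at the sink too. The level
  \<open>2 ^ j + (2 ^ j - 1)\<close> is the last one of block \<open>j\<close>.\<close>

lemma fam_in_block:
  assumes "e \<in> bd" "\<tau> j = (k, L)" "lev (fst i) < 2 ^ j" "\<forall>p\<in>set L. lev (fst p) \<le> 2 ^ j"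
    and "e \<notin> trapped (2 ^ j) (2 ^ j - 1)"
  shows "fam \<tau> i (vtx (2 ^ j + (2 ^ j - 1)) e) = (if k = i then cyl_fun L e else 0)"
proof -
  define c where "c = (if k = i then cyl_fun L e else 0)"
  have target: "target \<tau> i w = c" if "2 ^ j \<le> l" "l < 2 ^ j + (2 ^ j - 1)" "w \<in> ch (vtx l e)" for l w
    unfolding c_def using that by (intro target_in_block[OF assms(1), of \<tau> j k L i l] assms) auto
  obtain l where l: "2 ^ j \<le> l" "l < 2 ^ j + (2 ^ j - 1)" "free (vtx (Suc l) e)"
    using ex_free_vertex[OF assms(1,5)] by blast
  have "Suc l \<le> 2 ^ j + (2 ^ j - 1)" using l(2) by simp
  then have "fam \<tau> i (vtx (2 ^ j + (2 ^ j - 1)) e) = c"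
  proof (induction rule: dec_induct)
    case base
    show ?case using fam_free[OF l(3)] target[OF l(1,2) vtx_Suc[OF assms(1)]] by simp
  next
    case (step m)
    define x where "x = vtx m e"
    have child: "vtx (Suc m) e \<in> ch x" unfolding x_def by (rule vtx_Suc[OF assms(1)])
    have *: "fam \<tau> i w = c" if "w \<in> ch x" "free w" for w
      using fam_free[OF that(2)] target[of m w] step l that(1) by (simp add: x_def)
    \<comment> \<open>The weights sum to 1, so the constant \<open>c\<close> satisfies the same
      equation at \<open>x\<close>.\<close>
    have "(\<Sum>y\<in>ch x. of_real (q x y) * c) = c"
      using arg_cong[OF q_sum[of x], of complex_of_real] by (simp add: sum_distrib_right[symmetric])
    then have "(\<Sum>y\<in>ch x. of_real (q x y) * fam \<tau> i y) = (\<Sum>y\<in>ch x. of_real (q x y) * c)"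
      using harmonicD[OF fam_harmonic, of \<tau> i x] step.IH unfolding x_def by (simp only:)
    then have "fam \<tau> i (sink x) = c"
      by (rule sink_value_unique[where g = "\<lambda>_. c"]) (rule *)
    then show ?case using * child free_child[OF child] by (cases "free (vtx (Suc m) e)") auto
  qed
  then show ?thesis by (simp add: c_def)
qed

section \<open>Universality of nontrivial combinations\<close>

lemma borel_measurable_omega [measurable]: "omega E x0 n f \<in> borel_measurable M"
proof -
  have "omega E x0 n f e = (\<Sum>w\<in>level E x0 n. if w \<in> e then f w else 0)" if "e \<in> space M" for e
  proof -
    have e: "e \<in> bd" using that by (simp add: space_P)
    have "(\<Sum>w\<in>level E x0 n. if w \<in> e then f w else 0) = (\<Sum>w\<in>level E x0 n. if w = vtx n e then f w else 0)"
      using mem_ray_iff[OF e] by (intro sum.cong) (auto simp: level_def lev_vtx e)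
    then show ?thesis using finite_level[of n] lev_vtx[OF e, of n] by (simp add: omega_eq level_def)
  qed
  moreover have "(\<lambda>e. \<Sum>w\<in>level E x0 n. if w \<in> e then f w else 0) \<in> borel_measurable M"
    by (intro borel_measurable_sum borel_measurable_cyl)
  ultimately show ?thesis by (subst measurable_cong) auto
qed

text \<open>The constant 1 has distance 1/2 from 0. Combined with
  \<open>universal_combination\<close>, this yields the linear independence of the family.\<close>

lemma zero_not_universal: "0 \<notin> universal E x0 q M"
proof
  assume "0 \<in> universal E x0 q M"
  then have "dense_wrt (prob_dist M) (L0 M) {omega E x0 n 0 | n. 1 \<le> n}" by (simp add: universal_def)
  moreover have "(\<lambda>_. 1) \<in> L0 M" by (simp add: L0_def)
  ultimately obtain n where "prob_dist M (\<lambda>_. 1) (omega E x0 n 0) < 1 / 2"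
    unfolding dense_wrt_def using half_gt_zero[OF zero_less_one] by blast
  then show False by (simp add: prob_dist_def omega_eq prob_space)
qed

text \<open>In a late block with task \<open>(k, L)\<close> only the summand of \<open>k\<close>
  survives, off a small set. So it suffices that \<open>cyl_fun L\<close> approximates the given
  function divided by \<open>a k\<close>.\<close>

lemma universal_combination:
  assumes D: "\<And>U. open U \<Longrightarrow> U \<noteq> {} \<Longrightarrow> \<exists>d\<in>D. d \<in> U"
    and \<tau>: "\<And>i L J. L \<in> lists (UNIV \<times> D) \<Longrightarrow> \<exists>j\<ge>J. \<tau> j = (i, L)"
    and "finite S" "k \<in> S" "a k \<noteq> 0"
  shows "(\<lambda>v. \<Sum>i\<in>S. a i * fam \<tau> i v) \<in> universal E x0 q M"
proof -
  define f where "f = (\<lambda>v. \<Sum>i\<in>S. a i * fam \<tau> i v)"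
  have "(\<Sum>i\<in>S. (\<lambda>v. a i * fam \<tau> i v)) \<in> H"
    by (intro complex_fun.subspace_sum subspace_harmonic complex_fun.subspace_scale fam_harmonic)
  then have "f \<in> H" by (simp add: f_def sum_fun_apply[abs_def])
  moreover have "dense_wrt (prob_dist M) (L0 M) {omega E x0 n f | n. 1 \<le> n}"
    unfolding dense_wrt_def
  proof (intro conjI ballI allI impI)
    show "{omega E x0 n f | n. 1 \<le> n} \<subseteq> L0 M" by (auto simp: L0_def)
    fix \<psi> and \<epsilon> :: real
    assume "\<psi> \<in> L0 M" and \<epsilon>: "0 < \<epsilon>"
    then have [measurable]: "\<psi> \<in> borel_measurable M" by (simp add: L0_def)
    have c: "0 < 1 + cmod (a k)" by (simp add: add_pos_nonneg)
    \<comment> \<open>The divisor compensates the factor lost in \<open>pnorm_scale\<close> when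
      multiplying by \<open>a k\<close> again.\<close>
    have "0 < \<epsilon> / 2 / (1 + cmod (a k))" using \<epsilon> c by simp
    then obtain L where L: "L \<in> lists (UNIV \<times> D)"
        "pnorm M (\<lambda>e. \<psi> e / a k - cyl_fun L e) < \<epsilon> / 2 / (1 + cmod (a k))"
      using cyl_fun_dense[OF D, of "\<lambda>e. \<psi> e / a k"] by auto
    have "pnorm M (\<lambda>e. a k * (\<psi> e / a k - cyl_fun L e))
        \<le> (1 + cmod (a k)) * pnorm M (\<lambda>e. \<psi> e / a k - cyl_fun L e)"
      by (intro M.pnorm_scale) auto
    also have "\<dots> < \<epsilon> / 2" using L(2) c by (simp add: field_simps)
    finally have 1: "pnorm M (\<lambda>e. \<psi> e - a k * cyl_fun L e) < \<epsilon> / 2"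
      using assms(5) by (simp add: right_diff_distrib)
    have "(\<lambda>j. (1 / 2 :: real) ^ j) \<longlonglongrightarrow> 0" by (rule LIMSEQ_power_zero) simp
    then have "\<forall>\<^sub>F j in sequentially. (1 / 2) ^ j < \<epsilon> / 2"
      using \<epsilon> by (intro order_tendstoD(2)) auto
    moreover have ev: "\<forall>\<^sub>F j in sequentially. m < 2 ^ j" for m :: nat
      using eventually_ge_at_top[of m] by eventually_elim (meson le_less_trans less_exp)
    have "\<forall>\<^sub>F j in sequentially. \<forall>i\<in>S. lev (fst i) < 2 ^ j"
      using assms(3) ev by (intro eventually_ball_finite) auto
    moreover have "\<forall>\<^sub>F j in sequentially. \<forall>p\<in>set L. lev (fst p) < 2 ^ j"
      using ev by (intro eventually_ball_finite) auto
    ultimately have "\<forall>\<^sub>F j in sequentially. (1 / 2) ^ j < \<epsilon> / 2 \<and>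
        (\<forall>i\<in>S. lev (fst i) < 2 ^ j) \<and> (\<forall>p\<in>set L. lev (fst p) < 2 ^ j)"
      by eventually_elim blast
    then obtain J where J: "\<And>j. J \<le> j \<Longrightarrow> (1 / 2) ^ j < \<epsilon> / 2 \<and>
        (\<forall>i\<in>S. lev (fst i) < 2 ^ j) \<and> (\<forall>p\<in>set L. lev (fst p) < 2 ^ j)"
      unfolding eventually_sequentially by blast
    \<comment> \<open>The task recurs, so its block can be taken beyond the levels of all indices in
      \<open>S\<close> and all vertices in \<open>L\<close>.\<close>
    obtain j where "J \<le> j" and j: "\<tau> j = (k, L)" using \<tau>[OF L(1)] by blast
    have small: "(1 / 2) ^ j < \<epsilon> / 2" and S: "\<And>i. i \<in> S \<Longrightarrow> lev (fst i) < 2 ^ j"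
      and lev_L: "\<forall>p\<in>set L. lev (fst p) \<le> 2 ^ j"
      using J[OF \<open>J \<le> j\<close>] less_imp_le by blast+
    define n :: nat where "n = 2 ^ j + (2 ^ j - 1)"
    define B where "B = trapped (2 ^ j) (2 ^ j - 1)"
    \<comment> \<open>The block leaves \<open>2 ^ j - 1\<close> steps, hence at least
      \<open>j\<close>, for escaping the sinks.\<close>
    have "j \<le> 2 ^ j - 1" using less_exp[of j] by linarith
    then have "(1 / 2 :: real) ^ (2 ^ j - 1) \<le> (1 / 2) ^ j" by (intro power_decreasing) auto
    moreover have "prob B \<le> (1 / 2) ^ (2 ^ j - 1)" unfolding B_def by (intro prob_trapped) simp
    ultimately have "prob B < \<epsilon> / 2" using small by linarith
    then have "M.prob B < \<epsilon> / 2" using trapped_in_sets_P by (simp add: B_def)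
    moreover have "pnorm M (\<lambda>e. a k * cyl_fun L e - omega E x0 n f e) \<le> M.prob B"
    proof (rule M.pnorm_le_prob)
      show "B \<in> sets M" using trapped_in_sets_P by (simp add: B_def)
      fix e assume "e \<in> space M - B"
      then have "f (vtx n e) = (\<Sum>i\<in>S. a i * (if k = i then cyl_fun L e else 0))"
        unfolding f_def n_def B_def space_M using S j lev_L
        by (intro sum.cong refl arg_cong2[where f = "(*)"] fam_in_block) auto
      also have "\<dots> = (\<Sum>i\<in>S. if i = k then a k * cyl_fun L e else 0)"
        by (intro sum.cong) auto
      also have "\<dots> = a k * cyl_fun L e" using assms(3,4) by simp
      finally show "a k * cyl_fun L e - omega E x0 n f e = 0" by (simp add: omega_eq)
    qed simp
    ultimately have 2: "pnorm M (\<lambda>e. a k * cyl_fun L e - omega E x0 n f e) < \<epsilon> / 2" by simp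
    have "pnorm M (\<lambda>e. (\<psi> e - a k * cyl_fun L e) + (a k * cyl_fun L e - omega E x0 n f e))
        \<le> pnorm M (\<lambda>e. \<psi> e - a k * cyl_fun L e) + pnorm M (\<lambda>e. a k * cyl_fun L e - omega E x0 n f e)"
      by (intro M.pnorm_add) auto
    then have "prob_dist M \<psi> (omega E x0 n f) < \<epsilon>"
      using 1 2 by (simp add: prob_dist_eq_pnorm)
    moreover have "1 \<le> n" unfolding n_def by (intro trans_le_add1 one_le_power) simp
    ultimately show "\<exists>\<phi>\<in>{omega E x0 n f | n. 1 \<le> n}. prob_dist M \<psi> \<phi> < \<epsilon>" by blast
  qed
  ultimately show ?thesis by (simp add: universal_def f_def)
qed

section \<open>The two spans: density and trivial intersection\<close>

abbreviation F :: "(nat \<Rightarrow> ('v \<times> bool) \<times> ('v \<times> complex) list) \<Rightarrow> bool \<Rightarrow> ('v \<Rightarrow> complex) set" where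
  "F \<tau> b \<equiv> complex_fun.span (fam \<tau> ` (UNIV \<times> {b}))"

lemma F_harmonic: "F \<tau> b \<subseteq> H"
  using fam_harmonic subspace_harmonic by (intro complex_fun.span_minimal) auto

text \<open>The span provides coefficients on functions. They are moved to indices by choosing
  \<open>S\<close> such that \<open>fam \<tau>\<close> is injective on it, and zero coefficients are
  dropped so that any index in \<open>S\<close> can serve as the \<open>k\<close> of
  \<open>universal_combination\<close>.\<close>

lemma F_cases:
  assumes "g \<in> F \<tau> b"
  obtains S a where "finite S" "S \<subseteq> UNIV \<times> {b}" "\<And>i. i \<in> S \<Longrightarrow> a i \<noteq> 0"
    "g = (\<lambda>v. \<Sum>i\<in>S. a i * fam \<tau> i v)"
proof -
  from assms obtain T r where T: "finite T" "T \<subseteq> fam \<tau> ` (UNIV \<times> {b})"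
      "g = (\<Sum>h\<in>T. (\<lambda>v. r h * h v))"
    unfolding complex_fun.span_explicit by blast
  obtain S where S: "S \<subseteq> UNIV \<times> {b}" "inj_on (fam \<tau>) S" "T = fam \<tau> ` S"
    using T(2) unfolding subset_image_inj by blast
  have fin: "finite S" using T(1) S finite_imageD by blast
  show ?thesis
  proof (rule that)
    let ?S = "{i \<in> S. r (fam \<tau> i) \<noteq> 0}"
    show "finite ?S" "?S \<subseteq> UNIV \<times> {b}" "\<And>i. i \<in> ?S \<Longrightarrow> r (fam \<tau> i) \<noteq> 0"
      using fin S by auto
    have "g v = (\<Sum>i\<in>?S. r (fam \<tau> i) * fam \<tau> i v)" for v
    proof -
      have "g v = (\<Sum>i\<in>S. r (fam \<tau> i) * fam \<tau> i v)"
        unfolding T(3) S(3) sum_fun_apply by (simp add: sum.reindex[OF S(2)])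
      also have "\<dots> = (\<Sum>i\<in>?S. r (fam \<tau> i) * fam \<tau> i v)"
        using fin by (intro sum.mono_neutral_right) auto
      finally show ?thesis .
    qed
    then show "g = (\<lambda>v. \<Sum>i\<in>?S. r (fam \<tau> i) * fam \<tau> i v)" by auto
  qed
qed

text \<open>Level by level: a correction on level \<open>Suc N\<close> uses members that vanish on
  the levels above it. Only the free vertices have to be corrected, as \<open>harmonic_agree\<close>
  then settles the sinks.\<close>

lemma F_agree_upto:
  assumes "h \<in> H"
  shows "\<exists>g\<in>F \<tau> b. \<forall>v. lev v \<le> N \<longrightarrow> g v = h v"
proof (induction N)
  case 0
  have "(\<lambda>v. h x0 * fam \<tau> (x0, b) v) \<in> F \<tau> b"
    by (intro complex_fun.span_scale complex_fun.span_base) auto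
  moreover have "fam \<tau> (x0, b) x0 = 1" using fam_free[of x0] by (simp add: free_def target_def)
  ultimately show ?case by (intro bexI[of _ "\<lambda>v. h x0 * fam \<tau> (x0, b) v"]) auto
next
  case (Suc N)
  then obtain g where g: "g \<in> F \<tau> b" "\<And>v. lev v \<le> N \<Longrightarrow> g v = h v" by blast
  \<comment> \<open>At a free vertex \<open>v\<close> of this level only the term
    \<open>y = v\<close> is nonzero, and it equals \<open>h v - g v\<close>.\<close>
  define g' where "g' = g + (\<Sum>y\<in>level E x0 (Suc N). (\<lambda>v. (h y - g y) * fam \<tau> (y, b) v))"
  have "g' \<in> F \<tau> b" unfolding g'_def
    by (intro complex_fun.span_add g complex_fun.span_sum complex_fun.span_scale complex_fun.span_base) auto
  moreover have "g' v = h v" if "lev v \<le> Suc N" for v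
  proof (rule harmonic_agree[OF _ assms _ that])
    show "g' \<in> H" using \<open>g' \<in> F \<tau> b\<close> F_harmonic by blast
    fix v assume v: "free v" "lev v \<le> Suc N"
    have g'v: "g' v = g v + (\<Sum>y\<in>level E x0 (Suc N). (h y - g y) * fam \<tau> (y, b) v)"
      by (simp add: g'_def sum_fun_apply)
    show "g' v = h v"
    proof (cases "lev v = Suc N")
      case True
      have "(\<Sum>y\<in>level E x0 (Suc N). (h y - g y) * fam \<tau> (y, b) v)
          = (\<Sum>y\<in>level E x0 (Suc N). if y = v then h v - g v else 0)"
        using fam_free[OF v(1)] True by (intro sum.cong) (auto simp: target_def level_def)
      also have "\<dots> = h v - g v" using True finite_level[of "Suc N"] by (simp add: level_def)
      finally show ?thesis using g'v by simp
    next
      case False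
      then have "lev v \<le> N" using v(2) by simp
      then have "(\<Sum>y\<in>level E x0 (Suc N). (h y - g y) * fam \<tau> (y, b) v) = 0"
        by (intro sum.neutral) (auto simp: level_def fam_below)
      then show ?thesis using g'v g(2) \<open>lev v \<le> N\<close> by simp
    qed
  qed
  ultimately show ?case by blast
qed

lemma F_dense:
  fixes z :: "nat \<Rightarrow> 'v"
  shows "dense_wrt (pointwise_dist z) H (F \<tau> b)"
  unfolding dense_wrt_def
proof (intro conjI ballI allI impI F_harmonic)
  fix h and \<epsilon> :: real assume h: "h \<in> H" and \<epsilon>: "0 < \<epsilon>"
  obtain K where K: "(1 / 2) ^ K < \<epsilon>" using real_arch_pow_inv[OF \<epsilon>, of "1 / 2"] by auto
  \<comment> \<open>Every one of the first \<open>K\<close> enumerated vertices lies on a level up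
    to \<open>N\<close>.\<close>
  define N where "N = Max (insert 0 ((lev \<circ> z) ` {..<K}))"
  obtain g where g: "g \<in> F \<tau> b" "\<And>v. lev v \<le> N \<Longrightarrow> g v = h v"
    using F_agree_upto[OF h] by blast
  have "lev (z n) \<le> N" if "n < K" for n
    unfolding N_def using that by (intro Max_ge) auto
  then have "pointwise_dist z h g \<le> (1 / 2) ^ K" using g(2) by (intro pointwise_dist_le) simp
  then show "\<exists>g\<in>F \<tau> b. pointwise_dist z h g < \<epsilon>" using g(1) K by force
qed

lemma ex_dense_universal_subspaces:
  fixes z :: "nat \<Rightarrow> 'v"
  assumes "bij z"
  shows "\<exists>F1 F2.
    complex_fun.subspace F1 \<and> complex_fun.subspace F2 \<and>
    F1 \<subseteq> universal E x0 q M \<union> {0} \<and> F2 \<subseteq> universal E x0 q M \<union> {0} \<and>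
    dense_wrt (pointwise_dist z) H F1 \<and> dense_wrt (pointwise_dist z) H F2 \<and>
    F1 \<inter> F2 = {0}"
proof -
  obtain D :: "complex set" where D: "countable D" "\<And>U. open U \<Longrightarrow> U \<noteq> {} \<Longrightarrow> \<exists>d\<in>D. d \<in> U"
    by (rule countable_dense_setE) blast
  have "countable (range z)" by simp
  then have UNIV: "countable (UNIV :: 'v set)" using assms by (simp add: bij_is_surj)
  let ?T = "(UNIV :: ('v \<times> bool) set) \<times> lists ((UNIV :: 'v set) \<times> D)"
  have "countable ((UNIV :: 'v set) \<times> (UNIV :: bool set))"
    using UNIV by (intro countable_SIGMA) auto
  then have "countable ?T" using UNIV D(1) by (intro countable_SIGMA countable_lists) auto
  moreover have "?T \<noteq> {}" by auto
  ultimately have "\<exists>\<tau> :: nat \<Rightarrow> _. \<forall>x\<in>?T. \<forall>J. \<exists>j\<ge>J. \<tau> j = x"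
    by (rule infinitely_often_enumeration)
  then obtain \<tau> :: "nat \<Rightarrow> ('v \<times> bool) \<times> ('v \<times> complex) list"
    where "\<forall>x\<in>?T. \<forall>J. \<exists>j\<ge>J. \<tau> j = x" ..
  then have \<tau>: "\<exists>j\<ge>J. \<tau> j = (i, L)" if "L \<in> lists (UNIV \<times> D)" for i L J
    using that by (meson SigmaI UNIV_I)
  have universal: "(\<lambda>v. \<Sum>i\<in>S. a i * fam \<tau> i v) \<in> universal E x0 q M"
    if "finite S" "k \<in> S" "a k \<noteq> 0" for S k a
    using that by (rule universal_combination[where D = D, rotated 2]) (rule D(2) \<tau>; assumption)+
  have F_universal: "F \<tau> b \<subseteq> universal E x0 q M \<union> {0}" for b
  proof
    fix g assume "g \<in> F \<tau> b"
    then obtain S a where S: "finite S" "S \<subseteq> UNIV \<times> {b}" "\<And>i. i \<in> S \<Longrightarrow> a i \<noteq> 0"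
        "g = (\<lambda>v. \<Sum>i\<in>S. a i * fam \<tau> i v)"
      by (rule F_cases) blast
    show "g \<in> universal E x0 q M \<union> {0}"
    proof (cases "S = {}")
      case True
      then have "g = 0" using S(4) by auto
      then show ?thesis by simp
    next
      case False
      then obtain k where "k \<in> S" by blast
      then show ?thesis using universal[OF S(1), of k a] S(3,4) by simp
    qed
  qed
  have "g = 0" if g: "g \<in> F \<tau> True" "g \<in> F \<tau> False" for g
  proof -
    obtain S a where S: "finite S" "S \<subseteq> UNIV \<times> {True}" "\<And>i. i \<in> S \<Longrightarrow> a i \<noteq> 0"
        "g = (\<lambda>v. \<Sum>i\<in>S. a i * fam \<tau> i v)"
      by (rule F_cases[OF g(1)]) blast
    obtain S' a' where S': "finite S'" "S' \<subseteq> UNIV \<times> {False}" "\<And>i. i \<in> S' \<Longrightarrow> a' i \<noteq> 0"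
        "g = (\<lambda>v. \<Sum>i\<in>S'. a' i * fam \<tau> i v)"
      by (rule F_cases[OF g(2)]) blast
    have "S = {}"
    proof (rule ccontr)
      assume "S \<noteq> {}"
      then obtain k where k: "k \<in> S" by blast
      \<comment> \<open>Subtracting the two representations of \<open>g\<close> gives a combination
        over the disjoint union of \<open>S\<close> and \<open>S'\<close> that is zero, yet
        universal as \<open>a k\<close> is nonzero.\<close>
      define c where "c i = (if i \<in> S then a i else - a' i)" for i
      have disj: "S \<inter> S' = {}" using S(2) S'(2) by auto
      have "(\<lambda>v. \<Sum>i\<in>S \<union> S'. c i * fam \<tau> i v) \<in> universal E x0 q M"
        using S S' k by (intro universal[of _ k]) (auto simp: c_def)
      moreover have "(\<Sum>i\<in>S \<union> S'. c i * fam \<tau> i v) = 0" for v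
      proof -
        have "(\<Sum>i\<in>S \<union> S'. c i * fam \<tau> i v) = (\<Sum>i\<in>S. c i * fam \<tau> i v) + (\<Sum>i\<in>S'. c i * fam \<tau> i v)"
          using S(1) S'(1) disj by (rule sum.union_disjoint)
        also have "(\<Sum>i\<in>S. c i * fam \<tau> i v) = g v" unfolding S(4) by (simp add: c_def)
        also have "(\<Sum>i\<in>S'. c i * fam \<tau> i v) = (\<Sum>i\<in>S'. - (a' i * fam \<tau> i v))"
          using disj by (intro sum.cong) (auto simp: c_def)
        also have "\<dots> = - g v" unfolding S'(4) by (rule sum_negf)
        finally show ?thesis by simp
      qed
      ultimately have "(\<lambda>v. 0) \<in> universal E x0 q M" by simp
      then show False using zero_not_universal by (simp add: zero_fun_def)
    qed
    then show ?thesis using S(4) by auto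
  qed
  then have "F \<tau> True \<inter> F \<tau> False = {0}" using complex_fun.span_zero by auto
  then show ?thesis
    using F_universal F_dense by (intro exI[of _ "F \<tau> True"] exI[of _ "F \<tau> False"]) simp
qed

end

theorem theorem1p2:
  fixes E :: "'v \<Rightarrow> 'v \<Rightarrow> bool"
    and x0 :: 'v
    and q :: "'v \<Rightarrow> 'v \<Rightarrow> real"
    and M :: "'v set measure"
    and z :: "nat \<Rightarrow> 'v"
  assumes "is_tree E"
    and "\<And>n. finite (level E x0 n)"
    and "\<And>x. 2 \<le> card (children E x0 x)"
    and "\<And>x y. y \<in> children E x0 x \<Longrightarrow> 0 < q x y"
    and "\<And>x. (\<Sum>y\<in>children E x0 x. q x y) = 1"
    and "is_boundary_measure E x0 q M"
    and "bij z"
  shows "\<exists>F1 F2.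
    complex_fun.subspace F1 \<and> complex_fun.subspace F2 \<and>
    F1 \<subseteq> universal E x0 q M \<union> {0} \<and> F2 \<subseteq> universal E x0 q M \<union> {0} \<and>
    dense_wrt (pointwise_dist z) (harmonic E x0 q) F1 \<and>
    dense_wrt (pointwise_dist z) (harmonic E x0 q) F2 \<and>
    F1 \<inter> F2 = {0}"
proof -
  obtain P where P: "prob_space P" "space P = boundary E x0"
      "sets P = sigma_sets (boundary E x0) (\<Union>n\<in>{1..}. level_algebra E x0 n)"
      "\<forall>n\<ge>1. \<forall>y. y 0 = x0 \<and> (\<forall>j<n. y (Suc j) \<in> children E x0 (y j)) \<longrightarrow>
         measure P (cylinder E x0 (y n)) = (\<Prod>j<n. q (y j) (y (Suc j)))"
      "M = completion P"
    using assms(6) unfolding is_boundary_measure_def by blast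
  interpret prob_space P by (rule P(1))
  interpret boundary_walk E x0 P q
    by unfold_locales (use assms(1-5) P(2-4) in auto)
  show ?thesis using ex_dense_universal_subspaces[OF assms(7)] unfolding P(5) .
qed

end
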